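(* Let $p,q$ be positive integers, $n=p+q$, $X=\{1,\dots,n\}\cup\{-1,\dots,-n\}$, and let $\gamma=(1,\dots,p,-1,\dots,-p)(p+1,\dots,n,-(p+1),\dots,-n)\in B_n$. Then $$\mathcal{S}^B_{nc}(p,q)=\{\tau\in B_n \mid \tau\le\gamma\}.$$
   Context: $B_n$ is the hyperoctahedral group: all permutations $\tau$ of $X$ with $\tau(-i)=-\tau(i)$ for all $i$. For a permutation $\sigma$ of a finite set $S$, $\#(\sigma)$ is the number of orbits (cycles) of $\sigma$; for permutations $\tau,\gamma$ of $S$, $\#(\tau,\gamma)$ is the number of orbits of the action on $S$ of the subgroup generated by $\tau$ and $\gamma$. The set of non-crossing permutations of $S$ with respect to $\gamma$ is $\mathcal{S}_{nc}(S,\gamma)=\{\tau \in \mathrm{Sym}(S)\mid \#(\tau)+\#(\tau^{-1}\gamma)+\#(\gamma)=|S|+2\#(\tau,\gamma)\}$. Define $\mathcal{S}^B_{nc}(p,q)=\mathcal{S}_{nc}(X,\gamma)\cap B_n$. The length $\ell_B(\tau)$ of $\tau\in B_n$ is the smallest $k$ such that $\tau$ is a product of $k$ elements of the generating set $\{(i,j)(-i,-j),\ (i,-j)(-i,j) : 1\le i<j\le n\}\cup\{(i,-i): 1\le i\le n\}$ (equivalently, $n$ minus the number of pairs $\{A,-A\}$ of orbits of $\tau$ with $A\neq -A$). The partial order on $B_n$ is: $\sigma\le\tau$ iff $\ell_B(\tau)=\ell_B(\sigma)+\ell_B(\sigma^{-1}\tau)$. *)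

theory Defs
  imports "HOL-Algebra.Group_Action" "HOL-Algebra.Generated_Groups" "HOL-Combinatorics.Orbits"
    "HOL-Combinatorics.Cycles"
begin

(* Permutations of S are functions on the whole type that fix every point outside S. *)

definition sym_on :: "'a set \<Rightarrow> ('a \<Rightarrow> 'a) monoid"
  where "sym_on S = \<lparr>carrier = {f. f permutes S}, monoid.mult = (\<circ>), one = id\<rparr>"

definition num_cycles :: "'a set \<Rightarrow> ('a \<Rightarrow> 'a) \<Rightarrow> nat"
  where "num_cycles S \<sigma> = card (Orbits.orbit \<sigma> ` S)"

definition num_joint_orbits :: "'a set \<Rightarrow> ('a \<Rightarrow> 'a) \<Rightarrow> ('a \<Rightarrow> 'a) \<Rightarrow> nat"
  where "num_joint_orbits S \<tau> \<gamma> =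
    card (orbits (subgroup_generated (sym_on S) {\<tau>, \<gamma>}) S (\<lambda>g x. g x))"

(* inv_into UNIV is the inverse function; the notation inv of HOL-Algebra is the group inverse. *)

definition noncrossing_perms :: "'a set \<Rightarrow> ('a \<Rightarrow> 'a) \<Rightarrow> ('a \<Rightarrow> 'a) set"
  where "noncrossing_perms S \<gamma> =
    {\<tau>. \<tau> permutes S \<and>
        num_cycles S \<tau> + num_cycles S (inv_into UNIV \<tau> \<circ> \<gamma>) + num_cycles S \<gamma>
          = card S + 2 * num_joint_orbits S \<tau> \<gamma>}"

definition signed_set :: "nat \<Rightarrow> int set"
  where "signed_set n = {1..int n} \<union> uminus ` {1..int n}"

definition hyperoctahedral :: "nat \<Rightarrow> (int \<Rightarrow> int) set"
  where "hyperoctahedral n =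
    {\<tau>. \<tau> permutes signed_set n \<and> (\<forall>i\<in>signed_set n. \<tau> (- i) = - \<tau> i)}"

definition reflections_B :: "nat \<Rightarrow> (int \<Rightarrow> int) set"
  where "reflections_B n =
    {transpose i j \<circ> transpose (- i) (- j) | i j. 1 \<le> i \<and> i < j \<and> j \<le> int n} \<union>
    {transpose i (- j) \<circ> transpose (- i) j | i j. 1 \<le> i \<and> i < j \<and> j \<le> int n} \<union>
    {transpose i (- i) | i. 1 \<le> i \<and> i \<le> int n}"

definition length_B :: "nat \<Rightarrow> (int \<Rightarrow> int) \<Rightarrow> nat"
  where "length_B n \<tau> =
    (LEAST k. \<exists>rs. length rs = k \<and> set rs \<subseteq> reflections_B n \<and> foldr (\<circ>) rs id = \<tau>)"

definition le_B :: "nat \<Rightarrow> (int \<Rightarrow> int) \<Rightarrow> (int \<Rightarrow> int) \<Rightarrow> bool"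
  where "le_B n \<sigma> \<tau> \<longleftrightarrow>
    \<sigma> \<in> hyperoctahedral n \<and> \<tau> \<in> hyperoctahedral n \<and>
    length_B n \<tau> = length_B n \<sigma> + length_B n (inv_into UNIV \<sigma> \<circ> \<tau>)"

definition signed_cycle :: "int \<Rightarrow> int \<Rightarrow> int \<Rightarrow> int"
  where "signed_cycle a b = cycle_of_list ([a..b] @ map uminus [a..b])"

definition gamma_B :: "nat \<Rightarrow> nat \<Rightarrow> int \<Rightarrow> int"
  where "gamma_B p q =
    signed_cycle 1 (int p) \<circ> signed_cycle (int p + 1) (int (p + q))"

definition noncrossing_B :: "nat \<Rightarrow> nat \<Rightarrow> (int \<Rightarrow> int) set"
  where "noncrossing_B p q =
    noncrossing_perms (signed_set (p + q)) (gamma_B p q) \<inter> hyperoctahedral (p + q)"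

lemma group_sym_on: "group (sym_on S)"
proof (rule groupI)
  fix x assume "x \<in> carrier (sym_on S)"
  then show "\<exists>y\<in>carrier (sym_on S). y \<otimes>\<^bsub>sym_on S\<^esub> x = \<one>\<^bsub>sym_on S\<^esub>"
    by (auto simp: sym_on_def intro!: exI[of _ "inv_into UNIV x"] permutes_inv permutes_inv_o)
qed (auto simp: sym_on_def permutes_compose permutes_id o_assoc)

lemma signed_cycle_permutes:
  "signed_cycle a b permutes ({a..b} \<union> uminus ` {a..b})"
  using cycle_permutes[of "[a..b] @ map uminus [a..b]"] by (simp add: signed_cycle_def)

lemma signed_cycle_uminus:
  assumes "0 < a"
  shows "signed_cycle a b (- i) = - signed_cycle a b i"
proof -
  let ?u = "[a..b]" and ?v = "map uminus [a..b]"
  have d: "distinct (?u @ ?v)"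
    using assms by (auto simp: distinct_map inj_on_def)
  have "uminus \<circ> cycle_of_list (?u @ ?v) \<circ> inv_into UNIV uminus
      = cycle_of_list (map uminus (?u @ ?v))"
    by (rule conjugation_of_cycle[OF d]) (rule bij_uminus)
  also have "map uminus (?u @ ?v) = rotate (length ?u) (?u @ ?v)"
    by (simp only: rotate_append) (simp add: o_def)
  also have "cycle_of_list \<dots> = cycle_of_list (?u @ ?v)"
    using cycle_of_list_rotate_independent[OF d] by simp
  finally have "uminus \<circ> signed_cycle a b \<circ> inv_into UNIV uminus = signed_cycle a b"
    by (simp only: signed_cycle_def)
  then have "- signed_cycle a b (inv_into UNIV uminus (- i)) = signed_cycle a b (- i)"
    by (metis comp_apply)
  moreover have "inv_into UNIV uminus (- i) = i"
    by (rule inv_f_f) simp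
  ultimately show ?thesis by simp
qed

lemma gamma_B_in_hyperoctahedral: "gamma_B p q \<in> hyperoctahedral (p + q)"
proof -
  have "signed_cycle 1 (int p) permutes signed_set (p + q)"
    "signed_cycle (int p + 1) (int (p + q)) permutes signed_set (p + q)"
    by (rule permutes_subset[OF signed_cycle_permutes]; force simp: signed_set_def)+
  then show ?thesis
    by (simp add: hyperoctahedral_def gamma_B_def permutes_compose signed_cycle_uminus)
qed

end

theory Submission
  imports Defs
begin

text \<open>
  Write \<open>c\<close> for the number of cycles of a signed permutation on \<open>{\<plusminus>1, \<dots>, \<plusminus>n}\<close> and \<open>q\<close> for the
  number of cycles of the permutation it induces on absolute values. Then \<open>c - q\<close> counts the pairs of
  distinct cycles exchanged by negation, and \<open>length_B = n - (c - q)\<close>. With \<open>\<kappa> = \<tau>\<^sup>-\<^sup>1 \<gamma>\<close> and \<open>N\<close> the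
  number of joint orbits of \<open>\<tau>\<close> and \<open>\<gamma>\<close>, the noncrossing condition reads
  \<open>c \<tau> + c \<kappa> + 2 = 2 n + 2 N\<close>, and \<open>\<tau> \<le> \<gamma>\<close> reads \<open>c \<tau> + c \<kappa> = n + q \<tau> + q \<kappa>\<close>. They are
  equivalent because of three inequalities: the genus inequality \<open>c \<tau> + c \<kappa> + 2 \<le> 2 n + 2 N\<close>, the
  genus inequality \<open>q \<tau> + q \<kappa> + 2 \<le> n + 2 N\<close> of the quotient by negation, and
  \<open>c \<tau> + c \<kappa> + 2 N \<le> 2 (q \<tau> + q \<kappa>) + 2\<close>. The last one is \<open>c \<le> 2 q\<close> if \<open>N = 1\<close>; if \<open>N = 2\<close>, a parity
  argument shows that over each of the two cycles of \<open>\<gamma>\<close> some cycle of \<open>\<tau>\<close> or \<open>\<kappa>\<close> is invariant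
  under negation.
\<close>

section \<open>Counting cycles\<close>

text \<open>Encoding permutations as relations lets cycles of one permutation and joint orbits of
  two be treated alike: both are classes of a generated equivalence, of \<open>fgraph S f\<close>
  alone or of the \<open>sup\<close> of two graphs.\<close>

definition fgraph :: "'a set \<Rightarrow> ('a \<Rightarrow> 'a) \<Rightarrow> 'a \<Rightarrow> 'a \<Rightarrow> bool"
  where "fgraph S f x y \<longleftrightarrow> x \<in> S \<and> y = f x"

definition num_classes :: "'a set \<Rightarrow> ('a \<Rightarrow> 'a \<Rightarrow> bool) \<Rightarrow> nat"
  where "num_classes S E = card ((\<lambda>x. Collect (equivclp E x)) ` S)"

section \<open>Counting the classes of a generated equivalence relation\<close>

lemma equivclp_least:
  assumes "equivclp E x y" and "\<And>x y. E x y \<Longrightarrow> equivclp F x y"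
  shows "equivclp F x y"
  using assms(1)
proof (induction rule: equivclp_induct)
  case (step y z)
  then show ?case
    by (meson assms(2) equivclp_sym equivclp_trans)
qed simp

lemma Collect_equivclp_eq_iff:
  "Collect (equivclp E x) = Collect (equivclp E y) \<longleftrightarrow> equivclp E x y"
  by (auto intro: equivclp_sym equivclp_trans dest: equivclp_trans[OF equivclp_sym])

lemma num_classes_cong:
  assumes "\<And>x y. x \<in> S \<Longrightarrow> equivclp E x y \<longleftrightarrow> equivclp F x y"
  shows "num_classes S E = num_classes S F"
  unfolding num_classes_def using assms by (metis (mono_tags, lifting) Collect_cong image_cong)

lemma num_classes_eqI:
  assumes "\<And>x y. E x y \<Longrightarrow> equivclp F x y" and "\<And>x y. F x y \<Longrightarrow> equivclp E x y"
  shows "num_classes S E = num_classes S F"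
  by (rule num_classes_cong) (use assms equivclp_least in metis)

lemma fgraph_cong: "(\<And>x. x \<in> S \<Longrightarrow> f x = g x) \<Longrightarrow> fgraph S f = fgraph S g"
  by (auto simp: fgraph_def fun_eq_iff)

text \<open>The map \<open>f\<close> induces a map from classes of \<open>E\<close> to classes of
  \<open>F\<close> that hits every class of \<open>F\<close> meeting \<open>T\<close>. With
  \<open>f = id\<close> this compares a relation with a coarser one, with \<open>f = abs\<close> a
  permutation with its quotient.\<close>

lemma num_classes_image_le:
  assumes "finite S" and "T \<subseteq> f ` S"
    and "\<And>x y. x \<in> S \<Longrightarrow> y \<in> S \<Longrightarrow> equivclp E x y \<Longrightarrow> equivclp F (f x) (f y)"
  shows "num_classes T F \<le> num_classes S E"
proof -
  \<comment> \<open>The induced map may depend on the class alone, so it takes the union of the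
    \<open>F\<close>-classes of all images; intersecting with \<open>S\<close> stays within the
    reach of the hypothesis.\<close>
  let ?g = "\<lambda>C. {z. \<exists>x\<in>C \<inter> S. equivclp F (f x) z}"
  have g: "?g (Collect (equivclp E x)) = Collect (equivclp F (f x))" if "x \<in> S" for x
  proof (intro equalityI subsetI)
    fix z assume "z \<in> ?g (Collect (equivclp E x))"
    then show "z \<in> Collect (equivclp F (f x))"
      using assms(3) that by (auto intro: equivclp_trans)
  qed (use that in auto)
  have "(\<lambda>x. Collect (equivclp F x)) ` T \<subseteq> ?g ` ((\<lambda>x. Collect (equivclp E x)) ` S)"
  proof
    fix C assume "C \<in> (\<lambda>x. Collect (equivclp F x)) ` T"
    then obtain x where "x \<in> S" "C = Collect (equivclp F (f x))"
      using assms(2) by blast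
    then show "C \<in> ?g ` ((\<lambda>x. Collect (equivclp E x)) ` S)"
      using g[of x] by blast
  qed
  then show ?thesis
    unfolding num_classes_def using assms(1) by (intro surj_card_le) auto
qed

lemma num_classes_le_cardI:
  assumes "finite R" and "\<And>x. x \<in> S \<Longrightarrow> \<exists>r\<in>R. equivclp E r x"
  shows "num_classes S E \<le> card R"
proof -
  have "(\<lambda>x. Collect (equivclp E x)) ` S \<subseteq> (\<lambda>x. Collect (equivclp E x)) ` R"
  proof
    fix C assume "C \<in> (\<lambda>x. Collect (equivclp E x)) ` S"
    then obtain x r where "C = Collect (equivclp E x)" "r \<in> R" "equivclp E r x"
      using assms(2) by blast
    then show "C \<in> (\<lambda>x. Collect (equivclp E x)) ` R"
      using Collect_equivclp_eq_iff[of E r x] by blast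
  qed
  then show ?thesis
    unfolding num_classes_def using assms(1) by (meson surj_card_le)
qed

lemma ex_class_representatives:
  assumes "finite S"
  obtains R where "R \<subseteq> S" "card R = num_classes S E" "\<And>x. x \<in> S \<Longrightarrow> \<exists>r\<in>R. equivclp E r x"
proof -
  let ?c = "\<lambda>x. Collect (equivclp E x)"
  obtain R where R: "R \<subseteq> S" "inj_on ?c R" "?c ` S = ?c ` R"
    by (metis subset_image_inj order_refl)
  have "\<exists>r\<in>R. equivclp E r x" if "x \<in> S" for x
  proof -
    have "?c x \<in> ?c ` R"
      using that R(3) by blast
    then show ?thesis
      by (auto simp: Collect_equivclp_eq_iff intro: equivclp_sym)
  qed
  then show thesis
    using that[of R] R by (simp add: num_classes_def card_image)
qed

lemma equivclp_insert_edge: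
  fixes E :: "'a \<Rightarrow> 'a \<Rightarrow> bool" and a b :: 'a
  defines "F \<equiv> \<lambda>x y. E x y \<or> x = a \<and> y = b"
  shows "equivclp F x y \<longleftrightarrow> equivclp E x y \<or>
    (equivclp E a x \<or> equivclp E b x) \<and> (equivclp E a y \<or> equivclp E b y)"
proof
  have mono: "equivclp F u v" if "equivclp E u v" for u v
    using that by (rule equivclp_least) (auto simp: F_def)
  have ab: "equivclp F a b"
    by (auto simp: F_def)
  assume "equivclp E x y \<or>
    (equivclp E a x \<or> equivclp E b x) \<and> (equivclp E a y \<or> equivclp E b y)"
  then show "equivclp F x y"
    using mono ab by (meson equivclp_sym equivclp_trans)
next
  assume "equivclp F x y"
  then show "equivclp E x y \<or>
    (equivclp E a x \<or> equivclp E b x) \<and> (equivclp E a y \<or> equivclp E b y)"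
  proof (induction rule: equivclp_induct)
    case (step y z)
    then consider "equivclp E y z" | "y = a" "z = b" | "y = b" "z = a"
      by (auto simp: F_def)
    then show ?case
      using step.IH by cases (meson equivclp_sym equivclp_trans equivclp_refl)+
  qed simp
qed

text \<open>The edge fuses the classes of its end points and leaves all others alone. Cycle counts
  and joint orbit counts are later compared through such an added edge.\<close>

lemma num_classes_insert_edge:
  assumes "finite S" "a \<in> S" "b \<in> S"
  shows "num_classes S E =
    num_classes S (\<lambda>x y. E x y \<or> x = a \<and> y = b) + (if equivclp E a b then 0 else 1)"
proof (cases "equivclp E a b")
  case True
  then show ?thesis
    by (auto intro!: num_classes_eqI)
next
  case False
  let ?c = "\<lambda>x. Collect (equivclp E x)"
  let ?d = "\<lambda>x. Collect (equivclp (\<lambda>x y. E x y \<or> x = a \<and> y = b) x)"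
  \<comment> \<open>These are the classes untouched by the fusion: the old family adds two classes
    to \<open>?M\<close>, the new family adds one.\<close>
  let ?M = "?c ` S - {?c a, ?c b}"
  have d: "?d x = (if equivclp E a x \<or> equivclp E b x then ?c a \<union> ?c b else ?c x)" for x
  proof (cases "equivclp E a x \<or> equivclp E b x")
    case True
    then have "equivclp E x y \<Longrightarrow> equivclp E a y \<or> equivclp E b y" for y
      using equivclp_trans[of E] by blast
    then show ?thesis
      unfolding equivclp_insert_edge using True by auto
  qed (auto simp: equivclp_insert_edge)
  have "?d ` S = insert (?c a \<union> ?c b) ?M"
  proof (intro equalityI subsetI)
    fix C assume "C \<in> ?d ` S"
    then obtain x where x: "x \<in> S" "C = ?d x"
      by blast
    then show "C \<in> insert (?c a \<union> ?c b) ?M"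
      unfolding d by (auto simp: Collect_equivclp_eq_iff dest: equivclp_sym)
  next
    fix C assume "C \<in> insert (?c a \<union> ?c b) ?M"
    then consider "C = ?c a \<union> ?c b" | x where "x \<in> S" "C = ?c x" "C \<noteq> ?c a" "C \<noteq> ?c b"
      by blast
    then show "C \<in> ?d ` S"
    proof cases
      case 1
      then have "C = ?d a"
        unfolding d by simp
      then show ?thesis
        using assms(2) by blast
    next
      case 2
      then have "C = ?d x"
        unfolding d by (auto simp: Collect_equivclp_eq_iff dest: equivclp_sym)
      then show ?thesis
        using 2 by blast
    qed
  qed
  moreover have "?c a \<union> ?c b \<notin> ?M"
  proof
    assume "?c a \<union> ?c b \<in> ?M"
    then obtain x where "?c a \<union> ?c b = ?c x" "?c x \<noteq> ?c a"
      by blast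
    then show False
      by (metis Collect_equivclp_eq_iff UnCI equivclp_refl mem_Collect_eq)
  qed
  moreover have "card ?M = card (?c ` S) - 2"
    using assms False by (subst card_Diff_subset) (auto simp: Collect_equivclp_eq_iff)
  moreover have "card {?c a, ?c b} \<le> card (?c ` S)"
    using assms by (intro card_mono) auto
  then have "2 \<le> card (?c ` S)"
    using False by (simp add: Collect_equivclp_eq_iff)
  ultimately show ?thesis
    using False assms(1) by (simp add: num_classes_def)
qed

text \<open>A finite set mapped into itself by an injective map is mapped onto itself, so it is
  closed under preimages as well and no edge leaves it in either direction.\<close>

lemma equivclp_fgraph_closed:
  assumes "equivclp (fgraph S f) x y" "x \<in> A"
    and "finite A" "A \<subseteq> S" "inj_on f S" "f ` A \<subseteq> A"
  shows "y \<in> A"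
proof -
  have "f ` A = A"
    using assms by (meson endo_inj_surj inj_on_subset)
  show ?thesis
    using assms(1)
  proof (induction rule: equivclp_induct)
    case (step y z)
    then consider "z = f y" | "z \<in> S" "y = f z"
      by (auto simp: fgraph_def)
    then show ?case
    proof cases
      case 2
      then obtain w where "w \<in> A" "f w = f z"
        using step \<open>f ` A = A\<close> by (metis imageE)
      then show ?thesis
        using 2 assms(4,5) by (metis inj_onD subsetD)
    qed (use step assms(6) in auto)
  qed (use assms in simp)
qed

lemma bij_betw_funpow_mem: "bij_betw f S S \<Longrightarrow> x \<in> S \<Longrightarrow> (f ^^ k) x \<in> S"
  by (induction k) (auto simp: bij_betw_apply)

text \<open>The forward orbit of \<open>x\<close> is a finite set closed under \<open>f\<close>, so
  backward edges lead to no further points.\<close>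

lemma equivclp_fgraph_iff_funpow:
  assumes "finite S" "bij_betw f S S" "x \<in> S"
  shows "equivclp (fgraph S f) x y \<longleftrightarrow> (\<exists>k. y = (f ^^ k) x)"
proof
  let ?A = "range (\<lambda>k. (f ^^ k) x)"
  have sub: "?A \<subseteq> S"
    using assms bij_betw_funpow_mem by fastforce
  moreover have "f ` ?A \<subseteq> ?A"
    by (auto intro: range_eqI[of _ _ "Suc k" for k])
  moreover have "x \<in> ?A"
    by (auto intro: range_eqI[of _ _ 0])
  moreover assume "equivclp (fgraph S f) x y"
  ultimately have "y \<in> ?A"
    using assms by (intro equivclp_fgraph_closed[of S f x y])
      (auto simp: bij_betw_def finite_subset)
  then show "\<exists>k. y = (f ^^ k) x"
    by blast
next
  assume "\<exists>k. y = (f ^^ k) x"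
  moreover have "equivclp (fgraph S f) x ((f ^^ k) x)" for k
  proof (induction k)
    case (Suc k)
    have "fgraph S f ((f ^^ k) x) ((f ^^ Suc k) x)"
      using bij_betw_funpow_mem[OF assms(2,3)] by (simp add: fgraph_def)
    then show ?case
      using Suc equivclp_into_equivclp by metis
  qed simp
  ultimately show "equivclp (fgraph S f) x y"
    by blast
qed

section \<open>Composition with a transposition splits or merges cycles\<close>

lemma bij_betw_transpose_comp:
  "a \<in> S \<Longrightarrow> b \<in> S \<Longrightarrow> bij_betw f S S \<Longrightarrow> bij_betw (transpose a b \<circ> f) S S"
  by (rule bij_betw_trans) (auto intro: permutes_imp_bij permutes_swap_id)

text \<open>Take the arc of the cycle from \<open>a\<close> up to just before it first reaches
  \<open>b\<close>. The new map sends the last point of this arc back to \<open>a\<close>, so the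
  arc is closed and misses \<open>b\<close>.\<close>

lemma equivclp_transpose_split:
  assumes "finite S" "bij_betw f S S" "a \<in> S" "b \<in> S" "a \<noteq> b"
    and "equivclp (fgraph S f) a b"
  shows "\<not> equivclp (fgraph S (transpose a b \<circ> f)) a b"
proof
  assume conn: "equivclp (fgraph S (transpose a b \<circ> f)) a b"
  define k where "k = (LEAST k. b = (f ^^ k) a)"
  have k: "b = (f ^^ k) a"
    unfolding k_def using assms equivclp_fgraph_iff_funpow[OF assms(1-3)] by (metis (mono_tags) LeastI_ex)
  have least: "(f ^^ i) a \<noteq> b" if "i < k" for i
    using that not_less_Least unfolding k_def by metis
  \<comment> \<open>A return to \<open>a\<close> before time \<open>k\<close> could be cut out, and
    \<open>b\<close> would be reached earlier than \<open>k\<close>.\<close>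
  have ret: "(f ^^ i) a \<noteq> a" if "0 < i" "i < k" for i
  proof
    assume "(f ^^ i) a = a"
    moreover have "(f ^^ k) a = (f ^^ (k - i)) ((f ^^ i) a)"
      using that by (simp flip: comp_apply[of "f ^^ (k - i)"] funpow_add)
    ultimately have "(f ^^ (k - i)) a = b"
      using k by simp
    then show False
      using least[of "k - i"] that by simp
  qed
  have "k \<noteq> 0"
    using k assms(5) by (metis funpow_0)
  let ?A = "(\<lambda>i. (f ^^ i) a) ` {..<k}"
  have "(transpose a b \<circ> f) ((f ^^ i) a) \<in> ?A" if "i < k" for i
  proof (cases "Suc i = k")
    case True
    then have "f ((f ^^ i) a) = b"
      using k by auto
    then show ?thesis
      using \<open>k \<noteq> 0\<close> by (auto intro: image_eqI[of _ _ 0])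
  next
    case False
    then have "(transpose a b \<circ> f) ((f ^^ i) a) = (f ^^ Suc i) a"
      using ret[of "Suc i"] least[of "Suc i"] that by (simp add: transpose_apply_other)
    then show ?thesis
      using False that by (metis Suc_lessI imageI lessThan_iff)
  qed
  moreover have "a \<in> ?A"
    using \<open>k \<noteq> 0\<close> by (auto intro: image_eqI[of _ _ 0])
  moreover have "?A \<subseteq> S"
    using assms bij_betw_funpow_mem by fastforce
  moreover have "inj_on (transpose a b \<circ> f) S"
    using bij_betw_transpose_comp[OF assms(3,4,2)] by (simp add: bij_betw_def)
  ultimately have "b \<in> ?A"
    using conn by (intro equivclp_fgraph_closed[of S "transpose a b \<circ> f" a b]) auto
  then show False
    using least by auto
qed

text \<open>The new map follows the cycle of \<open>a\<close> under \<open>f\<close> up to the point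
  that \<open>f\<close> sends to \<open>a\<close>, and sends that point to \<open>b\<close>.\<close>

lemma equivclp_transpose_merge:
  assumes "finite S" "bij_betw f S S" "a \<in> S" "b \<in> S"
    and "\<not> equivclp (fgraph S f) a b"
  shows "equivclp (fgraph S (transpose a b \<circ> f)) a b"
proof -
  \<comment> \<open>The least such \<open>m\<close> is the length of the cycle of \<open>a\<close>;
    positivity excludes the trivial return at time 0.\<close>
  let ?P = "\<lambda>m. 0 < m \<and> (f ^^ m) a = a"
  have "fgraph S f a (f a)"
    using assms(3) by (simp add: fgraph_def)
  then have "equivclp (fgraph S f) (f a) a"
    by blast
  then obtain k where "a = (f ^^ k) (f a)"
    using equivclp_fgraph_iff_funpow[OF assms(1,2)] assms(2,3) by (metis bij_betw_apply)
  then have ex: "\<exists>m. ?P m"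
    by (metis funpow_swap1 funpow.simps(2) comp_apply zero_less_Suc)
  define m where "m = (LEAST m. ?P m)"
  have m: "0 < m" "(f ^^ m) a = a"
    using LeastI_ex[OF ex] unfolding m_def by auto
  have least: "(f ^^ i) a \<noteq> a" if "0 < i" "i < m" for i
    using that not_less_Least[of i ?P] unfolding m_def by auto
  have nb: "(f ^^ i) a \<noteq> b" for i
    using assms(5) equivclp_fgraph_iff_funpow[OF assms(1-3)] by metis
  have same: "((transpose a b \<circ> f) ^^ i) a = (f ^^ i) a" if "i < m" for i
    using that
  proof (induction i)
    case (Suc i)
    then show ?case
      using least[of "Suc i"] nb[of "Suc i"] by (simp add: transpose_apply_other)
  qed simp
  obtain i where "m = Suc i"
    using m(1) gr0_implies_Suc by blast
  then have "((transpose a b \<circ> f) ^^ m) a = b"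
    using same[of i] m(2) by simp
  then show ?thesis
    using equivclp_fgraph_iff_funpow[OF assms(1) bij_betw_transpose_comp[OF assms(3,4,2)] assms(3)]
    by metis
qed

abbreviation cycles :: "'a set \<Rightarrow> ('a \<Rightarrow> 'a) \<Rightarrow> nat"
  where "cycles S f \<equiv> num_classes S (fgraph S f)"

abbreviation linked :: "'a set \<Rightarrow> ('a \<Rightarrow> 'a) \<Rightarrow> 'a \<Rightarrow> 'a \<Rightarrow> bool"
  where "linked S f \<equiv> equivclp (fgraph S f)"

text \<open>Once \<open>a\<close> and \<open>b\<close> are joined by an edge, swapping them in the
  values of \<open>f\<close> changes no class. This common coarsening makes the cycle counts of
  \<open>f\<close> and of \<open>transpose a b \<circ> f\<close> comparable.\<close>

lemma cycles_transpose_aux: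
  assumes "finite S" "a \<in> S" "b \<in> S"
  shows "num_classes S (\<lambda>x y. fgraph S (transpose a b \<circ> f) x y \<or> x = a \<and> y = b) =
    num_classes S (\<lambda>x y. fgraph S f x y \<or> x = a \<and> y = b)"
proof -
  \<comment> \<open>Kept general in \<open>g\<close>: the second inclusion takes
    \<open>transpose a b \<circ> f\<close> for \<open>g\<close>, whose swapped value is
    \<open>f x\<close> again.\<close>
  have *: "equivclp (\<lambda>x y. fgraph S g x y \<or> x = a \<and> y = b) x (transpose a b (g x))"
    if "x \<in> S" for g x
  proof -
    let ?F = "\<lambda>x y. fgraph S g x y \<or> x = a \<and> y = b"
    have "equivclp ?F (g x) (transpose a b (g x))"
      by (auto simp: transpose_def)
    moreover have "equivclp ?F x (g x)"
      using that by (auto simp: fgraph_def)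
    ultimately show ?thesis
      by (rule equivclp_trans[rotated])
  qed
  show ?thesis
  proof (rule num_classes_eqI)
    fix x y assume "fgraph S (transpose a b \<circ> f) x y \<or> x = a \<and> y = b"
    then show "equivclp (\<lambda>x y. fgraph S f x y \<or> x = a \<and> y = b) x y"
      using *[of x f] by (auto simp: fgraph_def)
  next
    fix x y assume "fgraph S f x y \<or> x = a \<and> y = b"
    then show "equivclp (\<lambda>x y. fgraph S (transpose a b \<circ> f) x y \<or> x = a \<and> y = b) x y"
      using *[of x "transpose a b \<circ> f"] by (auto simp: fgraph_def)
  qed
qed

lemma cycles_transpose_split:
  assumes "finite S" "bij_betw f S S" "a \<in> S" "b \<in> S" "a \<noteq> b" "linked S f a b"
  shows "cycles S (transpose a b \<circ> f) = cycles S f + 1"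
  using num_classes_insert_edge[OF assms(1,3,4), of "fgraph S f"]
    num_classes_insert_edge[OF assms(1,3,4), of "fgraph S (transpose a b \<circ> f)"]
    cycles_transpose_aux[OF assms(1,3,4), of f] equivclp_transpose_split[OF assms] assms(6)
  by simp

lemma cycles_transpose_merge:
  assumes "finite S" "bij_betw f S S" "a \<in> S" "b \<in> S" "\<not> linked S f a b"
  shows "cycles S f = cycles S (transpose a b \<circ> f) + 1"
  using num_classes_insert_edge[OF assms(1,3,4), of "fgraph S f"]
    num_classes_insert_edge[OF assms(1,3,4), of "fgraph S (transpose a b \<circ> f)"]
    cycles_transpose_aux[OF assms(1,3,4), of f] equivclp_transpose_merge[OF assms] assms(5)
  by simp

text \<open>An edge of \<open>f\<close> may now end at the other of the two swapped points, but
  those two are linked after the merge.\<close>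

lemma linked_transpose_merge_mono:
  assumes "finite S" "bij_betw f S S" "a \<in> S" "b \<in> S" "\<not> linked S f a b" "linked S f x y"
  shows "linked S (transpose a b \<circ> f) x y"
  using assms(6)
proof (rule equivclp_least)
  fix x y assume *: "fgraph S f x y"
  then have "linked S (transpose a b \<circ> f) x (transpose a b y)"
    by (auto simp: fgraph_def)
  moreover have "linked S (transpose a b \<circ> f) (transpose a b y) y"
    using equivclp_transpose_merge[OF assms(1-5)] by (auto simp: transpose_def intro: equivclp_sym)
  ultimately show "linked S (transpose a b \<circ> f) x y"
    by (rule equivclp_trans)
qed

lemma cycles_id_on:
  assumes "\<And>x. x \<in> S \<Longrightarrow> f x = x"
  shows "cycles S f = card S"
proof -
  have "linked S f x y \<longleftrightarrow> x = y" for x y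
  proof
    assume "linked S f x y"
    then show "x = y"
      by (induction rule: equivclp_induct) (use assms in \<open>auto simp: fgraph_def\<close>)
  qed simp
  then have "(\<lambda>x. Collect (linked S f x)) ` S = (\<lambda>x. {x}) ` S"
    by auto
  then show ?thesis
    by (simp add: num_classes_def card_image)
qed

lemma cycles_le_card: "finite S \<Longrightarrow> cycles S f \<le> card S"
  unfolding num_classes_def by (rule card_image_le)

lemma fgraph_sup_id_on:
  assumes "\<And>x. x \<in> S \<Longrightarrow> f x = x"
  shows "num_classes S (sup (fgraph S f) (fgraph S g)) = cycles S g"
  by (rule num_classes_eqI) (use assms in \<open>auto simp: fgraph_def\<close>)

text \<open>
  Removing a transposition from \<open>r\<close> splits a cycle of \<open>r\<close> and changes the number of
  cycles of \<open>r \<circ> g\<close> by one; if the joint orbits split as well, the cycle of \<open>r \<circ> g\<close> through the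
  two points must split too.
\<close>

lemma genus:
  assumes "finite S" "bij_betw g S S" "bij_betw r S S"
  shows "cycles S r + cycles S (r \<circ> g) + cycles S g
      \<le> card S + 2 * num_classes S (sup (fgraph S r) (fgraph S g)) \<and>
    even (cycles S r + cycles S (r \<circ> g) + cycles S g + card S)"
  using assms(3)
\<comment> \<open>The measure is the number of transpositions still to be removed from
  \<open>r\<close>. When none is left, \<open>r\<close> is the identity on \<open>S\<close> and
  equality holds.\<close>
proof (induction "card S - cycles S r" arbitrary: r rule: less_induct)
  case less
  let ?j = "\<lambda>r. num_classes S (sup (fgraph S r) (fgraph S g))"
  show ?case
  proof (cases "\<forall>x\<in>S. r x = x")
    case True
    then have "cycles S (r \<circ> g) = cycles S g"
      using bij_betw_apply[OF assms(2)] by (metis comp_apply fgraph_cong)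
    then show ?thesis
      using True by (auto simp: cycles_id_on fgraph_sup_id_on)
  next
    case False
    then obtain a where a: "a \<in> S" "r a \<noteq> a"
      by blast
    \<comment> \<open>This choice makes \<open>a\<close> a fixed point of \<open>r'\<close>, split
      off from the cycle of \<open>r\<close> through \<open>a\<close>.\<close>
    define b where "b = r a"
    define r' where "r' = transpose a b \<circ> r"
    have b: "b \<in> S" "a \<noteq> b" "linked S r a b"
      using a bij_betw_apply[OF less.prems] by (auto simp: b_def fgraph_def)
    have r: "r = transpose a b \<circ> r'"
      by (simp add: r'_def fun_eq_iff)
    have bij: "bij_betw r' S S" "bij_betw (r' \<circ> g) S S"
      unfolding r'_def using a b assms(2) bij_betw_transpose_comp less.prems
      by (metis bij_betw_trans)+
    have split: "cycles S r' = cycles S r + 1"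
      unfolding r'_def using cycles_transpose_split[OF assms(1) less.prems a(1) b] .
    then have "card S - cycles S r' < card S - cycles S r"
      using cycles_le_card[OF assms(1), of r'] by simp
    note IH = less.hyps[OF this bij(1)]
    have rg: "r \<circ> g = transpose a b \<circ> (r' \<circ> g)"
      by (simp add: r o_assoc)
    let ?E = "sup (fgraph S r') (fgraph S g)"
    let ?F = "\<lambda>x y. ?E x y \<or> x = a \<and> y = b"
    \<comment> \<open>Every joint edge of \<open>r\<close> is a path of \<open>?F\<close>, and
      \<open>?F\<close> adds a single edge to the joint graph of \<open>r'\<close>. Hence at most
      one joint orbit is lost in passing from \<open>r'\<close> to \<open>r\<close>.\<close>
    have "?j r \<ge> num_classes S ?F"
    proof (rule num_classes_image_le[of _ _ id])
      fix x y assume "equivclp (sup (fgraph S r) (fgraph S g)) x y"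
      then have "equivclp ?F x y"
      proof (rule equivclp_least)
        fix x y assume "sup (fgraph S r) (fgraph S g) x y"
        then consider "fgraph S g x y" | "x \<in> S" "y = transpose a b (r' x)"
          unfolding r by (auto simp: fgraph_def)
        then show "equivclp ?F x y"
        proof cases
          case 1
          then show ?thesis by auto
        next
          case 2
          have "equivclp ?F x (r' x)"
            using 2 by (auto simp: fgraph_def)
          moreover have "equivclp ?F (r' x) y"
            using 2 by (auto simp: transpose_def)
          ultimately show ?thesis by (rule equivclp_trans)
        qed
      qed
      then show "equivclp ?F (id x) (id y)" by simp
    qed (use assms(1) in auto)
    then have j: "?j r' \<le> ?j r + (if equivclp ?E a b then 0 else 1)"
      using num_classes_insert_edge[OF assms(1) a(1) b(1), of ?E] by simp
    have sub: "equivclp ?E a b" if "linked S (r' \<circ> g) a b"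
      using that
    proof (rule equivclp_least)
      fix x y assume *: "fgraph S (r' \<circ> g) x y"
      then have "g x \<in> S"
        using bij_betw_apply[OF assms(2)] by (auto simp: fgraph_def)
      then have "?E (g x) y" "?E x (g x)"
        using * by (auto simp: fgraph_def)
      then show "equivclp ?E x y"
        by (meson equivclp_trans r_into_equivclp)
    qed
    show ?thesis
    \<comment> \<open>Passing from \<open>r'\<close> to \<open>r\<close>, the left side keeps its
      value if \<open>r \<circ> g\<close> gains a cycle, and then no joint orbit is lost. Otherwise
      it drops by two, which pays for one lost joint orbit.\<close>
    proof (cases "linked S (r' \<circ> g) a b")
      case True
      then have "cycles S (r \<circ> g) = cycles S (r' \<circ> g) + 1"
        unfolding rg using cycles_transpose_split[OF assms(1) bij(2) a(1) b(1,2)] by simp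
      then show ?thesis
        using IH split j True sub by simp
    next
      case False
      then have "cycles S (r' \<circ> g) = cycles S (r \<circ> g) + 1"
        unfolding rg using cycles_transpose_merge[OF assms(1) bij(2) a(1) b(1)] by simp
      then show ?thesis
        using IH split j by (auto split: if_splits)
    qed
  qed
qed

section \<open>Signed permutations and their quotient by negation\<close>

lemma linked_permutes_orbit:
  assumes "finite S" "f permutes S" "x \<in> S"
  shows "Collect (linked S f x) = Orbits.orbit f x"
proof -
  have "permutation f"
    using assms permutation_permutes by blast
  then show ?thesis
    using equivclp_fgraph_iff_funpow[OF assms(1) permutes_imp_bij[OF assms(2)] assms(3)]
    by (auto simp: orbit_altdef_permutation)
qed

lemma num_cycles_eq_cycles:
  assumes "finite S" "f permutes S"
  shows "num_cycles S f = cycles S f"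
  unfolding num_cycles_def num_classes_def
  using linked_permutes_orbit[OF assms] by (metis (mono_tags, lifting) image_cong)

lemma inv_sym_on:
  assumes "f permutes S"
  shows "m_inv (sym_on S) f = inv_into UNIV f"
  by (rule group.inv_equality[OF group_sym_on])
    (use assms in \<open>auto simp: sym_on_def permutes_inv_o permutes_inv\<close>)

text \<open>Induction over the generated subgroup turns the action of each element into a path in
  the two graphs. Conversely, an edge applies a generator or, run backwards, its inverse, so a path
  composes to a group element.\<close>

lemma joint_orbit_eq_class:
  assumes "f permutes S" "g permutes S" "x \<in> S"
  shows "Group_Action.orbit (subgroup_generated (sym_on S) {f, g}) (\<lambda>h y. h y) x =
    Collect (equivclp (sup (fgraph S f) (fgraph S g)) x)"
proof -
  let ?E = "sup (fgraph S f) (fgraph S g)"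
  let ?H = "generate (sym_on S) {f, g}"
  have car: "carrier (subgroup_generated (sym_on S) {f, g}) = ?H"
    using assms by (simp add: carrier_subgroup_generated sym_on_def)
  have H_perm: "h permutes S" if "h \<in> ?H" for h
    using group.generate_in_carrier[OF group_sym_on _ that] assms by (auto simp: sym_on_def)
  have gen: "equivclp ?E y (h y)" if "h \<in> ?H" "y \<in> S" for h y
    using that
  proof (induction arbitrary: y rule: generate.induct)
    case one
    then show ?case by (simp add: sym_on_def)
  next
    case (incl h)
    then show ?case by (auto simp: fgraph_def)
  next
    case (inv h)
    then have h: "h permutes S"
      using assms by auto
    then have "?E (inv_into UNIV h y) y"
      using inv permutes_in_image[OF permutes_inv[OF h]] permutes_inverses(1)[OF h]
      by (auto simp: fgraph_def)
    then show ?case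
      using inv_sym_on[OF h] by auto
  next
    case (eng h1 h2)
    then have "h2 y \<in> S"
      using H_perm permutes_in_image by metis
    then have "equivclp ?E y (h1 (h2 y))"
      using eng equivclp_trans by metis
    moreover have "h1 \<otimes>\<^bsub>sym_on S\<^esub> h2 = h1 \<circ> h2"
      by (simp add: sym_on_def)
    ultimately show ?case
      by (simp only: comp_apply)
  qed
  have "\<exists>h\<in>?H. h x = y" if "equivclp ?E x y" for y
    using that
  proof (induction rule: equivclp_induct)
    case base
    have "id \<in> ?H"
      using generate.one[of "sym_on S"] by (simp add: sym_on_def)
    then show ?case
      by (rule bexI[rotated]) simp
  next
    case (step y z)
    then obtain h where h: "h \<in> ?H" "h x = y"
      by blast
    have "\<exists>k\<in>?H. z = k y"
    proof -
      obtain k where k: "k \<in> {f, g}" "z = k y \<or> y = k z"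
        using step(2) by (auto simp: fgraph_def)
      then have kS: "k permutes S"
        using assms by auto
      show ?thesis
      proof (cases "z = k y")
        case True
        then show ?thesis
          using k generate.incl by metis
      next
        case False
        then have "z = inv_into UNIV k y"
          using k kS permutes_inverses(2) by metis
        then show ?thesis
          using k generate.inv inv_sym_on[OF kS] by metis
      qed
    qed
    then obtain k where k: "k \<in> ?H" "z = k y"
      by blast
    then have "k \<circ> h \<in> ?H"
      using generate.eng[OF k(1) h(1)] by (simp add: sym_on_def)
    then show ?case
      using h k by (metis comp_apply)
  qed
  then show ?thesis
    using gen assms(3) unfolding Group_Action.orbit_def car by auto
qed

lemma num_joint_orbits_eq_num_classes:
  assumes "f permutes S" "g permutes S"
  shows "num_joint_orbits S f g = num_classes S (sup (fgraph S f) (fgraph S g))"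
  unfolding num_joint_orbits_def num_classes_def orbits_def
  using joint_orbit_eq_class[OF assms]
  by (intro arg_cong[where f = card]) (auto simp: image_iff)

text \<open>This lets a permutation be replaced by its inverse in all counts, since the equivalence
  closure ignores the direction of edges. Inversion is required on \<open>S\<close> only, because
  quotient maps \<open>abs \<circ> f\<close> are bijective only on sets of absolute values.\<close>

lemma fgraph_inverse:
  assumes "bij_betw f S S" "\<And>x. x \<in> S \<Longrightarrow> g (f x) = x"
  shows "fgraph S g = (fgraph S f)\<inverse>\<inverse>"
proof -
  have "fgraph S g x y \<longleftrightarrow> fgraph S f y x" for x y
  proof
    assume "fgraph S g x y"
    then obtain z where "z \<in> S" "x = f z" "y = g x"
      using assms(1) by (auto simp: fgraph_def bij_betw_def)
    then show "fgraph S f y x"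
      using assms(2) by (simp add: fgraph_def)
  qed (use assms in \<open>auto simp: fgraph_def bij_betw_def\<close>)
  then show ?thesis
    by (auto simp: fun_eq_iff)
qed

lemma cycles_inverse:
  assumes "bij_betw f S S" "\<And>x. x \<in> S \<Longrightarrow> g (f x) = x"
  shows "cycles S g = cycles S f"
proof -
  have "fgraph S g = (fgraph S f)\<inverse>\<inverse>"
    using assms by (rule fgraph_inverse)
  then show ?thesis
    by (simp add: num_classes_def)
qed

lemma num_classes_sup_inverse:
  assumes "bij_betw f S S" "\<And>x. x \<in> S \<Longrightarrow> g (f x) = x"
  shows "num_classes S (sup (fgraph S g) E) = num_classes S (sup (fgraph S f) E)"
proof -
  have "fgraph S g = (fgraph S f)\<inverse>\<inverse>"
    using assms by (rule fgraph_inverse)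
  then show ?thesis
    by (intro num_classes_eqI) auto
qed

lemma cycles_Un_disjoint:
  assumes "finite A" "finite B" "A \<inter> B = {}" "bij_betw f A A" "bij_betw f B B"
  shows "cycles (A \<union> B) f = cycles A f + cycles B f"
proof -
  let ?c = "\<lambda>S x. Collect (linked S f x)"
  have bij: "bij_betw f (A \<union> B) (A \<union> B)"
    using assms by (intro bij_betw_combine)
  have A: "?c (A \<union> B) x = ?c A x" "?c A x \<subseteq> A" if "x \<in> A" for x
    using that assms bij equivclp_fgraph_iff_funpow[of "A \<union> B" f x]
      equivclp_fgraph_iff_funpow[of A f x] bij_betw_funpow_mem[of f A x] by auto
  have B: "?c (A \<union> B) x = ?c B x" "?c B x \<subseteq> B" if "x \<in> B" for x
    using that assms bij equivclp_fgraph_iff_funpow[of "A \<union> B" f x]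
      equivclp_fgraph_iff_funpow[of B f x] bij_betw_funpow_mem[of f B x] by auto
  have "?c (A \<union> B) ` (A \<union> B) = ?c A ` A \<union> ?c B ` B"
    using A(1) B(1) by (simp add: image_Un)
  moreover have "?c A ` A \<inter> ?c B ` B = {}"
  proof (rule ccontr)
    assume "?c A ` A \<inter> ?c B ` B \<noteq> {}"
    then obtain x y where xy: "x \<in> A" "y \<in> B" "?c A x = ?c B y"
      by blast
    have "x \<in> ?c A x"
      by simp
    then have "x \<in> B"
      using xy B(2) by blast
    then show False
      using xy(1) assms(3) by blast
  qed
  ultimately show ?thesis
    using assms(1,2) by (simp add: num_classes_def card_Un_disjoint)
qed

text \<open>Allowing any finite set closed under negation, with no condition outside it, makes the
  notion applicable to each block of \<gamma> separately. The quotient by negation is represented by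
  the absolute values of \<open>S\<close> with the map \<open>abs \<circ> f\<close>.\<close>

definition signed_perm :: "int set \<Rightarrow> (int \<Rightarrow> int) \<Rightarrow> bool"
  where "signed_perm S f \<longleftrightarrow> finite S \<and> 0 \<notin> S \<and> (\<forall>x\<in>S. - x \<in> S) \<and>
    bij_betw f S S \<and> (\<forall>x\<in>S. f (- x) = - f x)"

lemma signed_permD:
  assumes "signed_perm S f"
  shows "finite S" "0 \<notin> S" "bij_betw f S S" "finite (abs ` S)"
    "x \<in> S \<Longrightarrow> - x \<in> S" "x \<in> S \<Longrightarrow> f (- x) = - f x" "x \<in> S \<Longrightarrow> f x \<in> S" "abs ` S \<subseteq> S"
    "x \<in> S \<Longrightarrow> \<bar>f \<bar>x\<bar>\<bar> = \<bar>f x\<bar>"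
  using assms by (auto simp: signed_perm_def bij_betw_apply abs_if)

lemma signed_perm_comp:
  assumes "signed_perm S f" "signed_perm S g"
  shows "signed_perm S (f \<circ> g)"
  unfolding signed_perm_def
  using assms signed_permD[OF assms(1)] signed_permD[OF assms(2)] by (auto intro: bij_betw_trans)

lemma bij_betw_abs_comp:
  assumes "signed_perm S f"
  shows "bij_betw (abs \<circ> f) (abs ` S) (abs ` S)"
proof -
  note f = signed_permD[OF assms]
  have "(abs \<circ> f) ` abs ` S = abs ` f ` S"
    using f(9) by (force simp: image_iff)
  also have "\<dots> = abs ` S"
    using f(3) by (simp add: bij_betw_def)
  finally show ?thesis
    using f(4) by (simp add: bij_betw_def finite_surj_inj)
qed

lemma linked_uminus:
  assumes "signed_perm S f" "linked S f x y"
  shows "linked S f (- x) (- y)"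
  using assms(2)
proof (induction rule: equivclp_induct)
  case (step y z)
  then have "fgraph S f (- y) (- z) \<or> fgraph S f (- z) (- y)"
    using signed_permD[OF assms(1)] by (auto simp: fgraph_def)
  then show ?case
    using step equivclp_into_equivclp by metis
qed simp

lemma equivclp_map:
  assumes "equivclp E x y" and "\<And>x y. E x y \<Longrightarrow> equivclp F (h x) (h y)"
  shows "equivclp F (h x) (h y)"
  using assms(1)
proof (induction rule: equivclp_induct)
  case (step y z)
  then show ?case
    by (meson assms(2) equivclp_sym equivclp_trans)
qed simp

lemma fgraph_abs_comp:
  assumes "signed_perm S f" "fgraph S f x y"
  shows "fgraph (abs ` S) (abs \<circ> f) \<bar>x\<bar> \<bar>y\<bar>"
  using assms(2) signed_permD[OF assms(1)] by (auto simp: fgraph_def)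

lemma linked_abs_comp:
  assumes "signed_perm S f" "linked S f x y"
  shows "linked (abs ` S) (abs \<circ> f) \<bar>x\<bar> \<bar>y\<bar>"
  using assms(2) by (rule equivclp_map) (use fgraph_abs_comp[OF assms(1)] in blast)

text \<open>A path in the quotient lifts edge by edge, each edge up to a sign. Negation preserves
  linkage, so the signs can be collected at the end point.\<close>

lemma linked_of_linked_abs_comp:
  assumes "signed_perm S f" "linked (abs ` S) (abs \<circ> f) x y"
  shows "linked S f x y \<or> linked S f x (- y)"
  using assms(2)
proof (induction rule: equivclp_induct)
  case (step y z)
  note u = linked_uminus[OF assms(1)]
  have *: "linked S f v w \<or> linked S f v (- w)" if "fgraph (abs ` S) (abs \<circ> f) v w" for v w
  proof -
    have "v \<in> S" "w = \<bar>f v\<bar>"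
      using that signed_permD(8)[OF assms(1)] by (auto simp: fgraph_def)
    then have "fgraph S f v w \<or> fgraph S f v (- w)"
      by (auto simp: fgraph_def abs_if)
    then show ?thesis
      by blast
  qed
  have "linked S f y z \<or> linked S f y (- z)"
    using step(2) *[of y z] *[of z y] u[of z "- y"] by (auto dest: equivclp_sym)
  then show ?case
    using step.IH u[of y z] u[of y "- z"] by (auto dest: equivclp_trans)
qed simp

lemma linked_abs_comp_iff:
  assumes "signed_perm S f"
  shows "linked (abs ` S) (abs \<circ> f) \<bar>x\<bar> \<bar>y\<bar> \<longleftrightarrow> linked S f x y \<or> linked S f x (- y)"
proof
  assume "linked (abs ` S) (abs \<circ> f) \<bar>x\<bar> \<bar>y\<bar>"
  then have "linked S f (abs x) (abs y) \<or> linked S f (abs x) (- abs y)"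
    by (rule linked_of_linked_abs_comp[OF assms])
  then show "linked S f x y \<or> linked S f x (- y)"
    using linked_uminus[OF assms, of "- x" y] linked_uminus[OF assms, of "- x" "- y"]
    by (auto simp: abs_if split: if_splits)
next
  assume "linked S f x y \<or> linked S f x (- y)"
  then show "linked (abs ` S) (abs \<circ> f) \<bar>x\<bar> \<bar>y\<bar>"
    using linked_abs_comp[OF assms, of x y] linked_abs_comp[OF assms, of x "- y"] by auto
qed

text \<open>Over each quotient cycle lie at most two cycles, those through a representative and
  through its negative.\<close>

lemma cycles_le_double_cycles_abs:
  assumes "signed_perm S f"
  shows "cycles S f \<le> 2 * cycles (abs ` S) (abs \<circ> f)"
proof -
  note f = signed_permD[OF assms]
  obtain R where R: "R \<subseteq> abs ` S" "card R = cycles (abs ` S) (abs \<circ> f)"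
    "\<And>x. x \<in> abs ` S \<Longrightarrow> \<exists>r\<in>R. linked (abs ` S) (abs \<circ> f) r x"
    using ex_class_representatives[OF f(4)] by metis
  have "finite R"
    using R(1) f(4) finite_subset by blast
  have "cycles S f \<le> card (R \<union> uminus ` R)"
  proof (rule num_classes_le_cardI)
    fix x assume "x \<in> S"
    then obtain r where r: "r \<in> R" "linked (abs ` S) (abs \<circ> f) r \<bar>x\<bar>"
      using R(3) by blast
    moreover have "\<bar>r\<bar> = r"
      using r R(1) by auto
    ultimately have "linked S f r x \<or> linked S f r (- x)"
      using linked_abs_comp_iff[OF assms, of r x] by simp
    then show "\<exists>r\<in>R \<union> uminus ` R. linked S f r x"
      using r linked_uminus[OF assms, of r "- x"] by auto
  qed (use \<open>finite R\<close> in simp)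
  also have "\<dots> \<le> card R + card (uminus ` R)"
    by (rule card_Un_le)
  also have "card (uminus ` R) = card R"
    by (rule card_image) simp
  finally show ?thesis
    using R(2) by simp
qed

lemma cycles_abs_le_cycles:
  assumes "signed_perm S f"
  shows "cycles (abs ` S) (abs \<circ> f) \<le> cycles S f"
  by (rule num_classes_image_le[where f = abs])
    (use signed_permD[OF assms] linked_abs_comp[OF assms] in auto)

lemma card_eq_double_card_abs:
  assumes "signed_perm S f"
  shows "card S = 2 * card (abs ` S)"
proof -
  note f = signed_permD[OF assms]
  have "S = abs ` S \<union> uminus ` abs ` S"
  proof (intro equalityI subsetI)
    fix x assume "x \<in> S"
    then show "x \<in> abs ` S \<union> uminus ` abs ` S"
      by (cases "0 \<le> x") (force simp: image_iff)+
  qed (use f in \<open>auto simp: abs_if\<close>)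
  moreover have "abs ` S \<inter> uminus ` abs ` S = {}"
  proof (rule ccontr)
    assume "abs ` S \<inter> uminus ` abs ` S \<noteq> {}"
    then obtain x y where "x \<in> S" "\<bar>x\<bar> = - \<bar>y\<bar>"
      by auto
    moreover from this have "x = 0"
      by linarith
    ultimately show False
      using f(2) by simp
  qed
  then have "card (abs ` S \<union> uminus ` abs ` S) = card (abs ` S) + card (uminus ` abs ` S)"
    using f(4) by (intro card_Un_disjoint) auto
  moreover have "card (uminus ` abs ` S) = card (abs ` S)"
    by (rule card_image) simp
  ultimately show ?thesis
    by simp
qed

text \<open>This is \<open>genus\<close> for the quotient maps, as passing to the quotient respects
  composition. Absolute values map joint orbits onto joint orbits of the quotient, so the number of
  joint orbits in \<open>S\<close> may stand on the right.\<close>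

lemma genus_abs:
  assumes "signed_perm S r" "signed_perm S g"
  shows "cycles (abs ` S) (abs \<circ> r) + cycles (abs ` S) (abs \<circ> (r \<circ> g)) + cycles (abs ` S) (abs \<circ> g)
    \<le> card (abs ` S) + 2 * num_classes S (sup (fgraph S r) (fgraph S g))"
proof -
  let ?T = "abs ` S" and ?E = "sup (fgraph S r) (fgraph S g)"
  let ?F = "sup (fgraph ?T (abs \<circ> r)) (fgraph ?T (abs \<circ> g))"
  have "cycles ?T (abs \<circ> (r \<circ> g)) = cycles ?T ((abs \<circ> r) \<circ> (abs \<circ> g))"
    using signed_permD(7,8)[OF assms(2)] signed_permD(9)[OF assms(1)]
    by (intro arg_cong[where f = "num_classes ?T"] fgraph_cong) auto
  moreover have "num_classes ?T ?F \<le> num_classes S ?E"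
  proof (rule num_classes_image_le[where f = abs])
    fix x y assume "equivclp ?E x y"
    then show "equivclp ?F \<bar>x\<bar> \<bar>y\<bar>"
      by (rule equivclp_map) (use fgraph_abs_comp[OF assms(1)] fgraph_abs_comp[OF assms(2)] in blast)
  qed (use signed_permD(1)[OF assms(1)] in auto)
  ultimately show ?thesis
    using genus[OF signed_permD(4)[OF assms(1)] bij_betw_abs_comp[OF assms(2)] bij_betw_abs_comp[OF assms(1)]]
    by simp
qed

text \<open>
  Restricted to a block on which \<open>g\<close> is a single cycle, the number of cycles of \<open>r\<close> and
  \<open>r \<circ> g\<close> is odd by parity, hence one of these cycles is invariant under negation.
\<close>

lemma cycles_single_block:
  assumes "signed_perm S r" "signed_perm S g" "cycles S g = 1"
  shows "cycles S r + cycles S (r \<circ> g) + 1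
    \<le> 2 * (cycles (abs ` S) (abs \<circ> r) + cycles (abs ` S) (abs \<circ> (r \<circ> g)))"
proof -
  have "even (cycles S r + cycles S (r \<circ> g) + 1 + card S)"
    using genus[OF signed_permD(1,3)[OF assms(2)] signed_permD(3)[OF assms(1)]] assms(3) by simp
  then have "odd (cycles S r + cycles S (r \<circ> g))"
    using card_eq_double_card_abs[OF assms(1)] by simp
  moreover have "cycles S r + cycles S (r \<circ> g)
    \<le> 2 * (cycles (abs ` S) (abs \<circ> r) + cycles (abs ` S) (abs \<circ> (r \<circ> g)))"
    using cycles_le_double_cycles_abs[OF assms(1)]
      cycles_le_double_cycles_abs[OF signed_perm_comp[OF assms(1,2)]] by simp
  \<comment> \<open>An odd number bounded by an even one lies strictly below it.\<close>
  ultimately show ?thesis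
    by (metis Suc_eq_plus1 dvd_triv_left le_neq_implies_less Suc_leI)
qed

text \<open>Being injective, \<open>f\<close> maps the finite set \<open>A\<close> onto itself and
  therefore permutes the complement as well.\<close>

lemma signed_perm_subset:
  assumes "signed_perm S f" "A \<subseteq> S" "\<And>x. x \<in> A \<Longrightarrow> - x \<in> A" "f ` A \<subseteq> A"
  shows "signed_perm A f" "signed_perm (S - A) f"
proof -
  note f = signed_permD[OF assms(1)]
  have "finite A" "inj_on f A"
    using f assms by (auto simp: bij_betw_def intro: finite_subset inj_on_subset)
  then have bij: "bij_betw f A A"
    using assms(4) by (simp add: bij_betw_def endo_inj_surj)
  then show "signed_perm A f"
    using f assms by (auto simp: signed_perm_def finite_subset)
  have "bij_betw f (S - A) (S - A)"
    using assms(2) bij f(3) inj_on_image_set_diff[of f S S A]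
    by (auto simp: bij_betw_def intro: inj_on_subset)
  moreover have "- x \<notin> A" if "x \<notin> A" for x
    using assms(3)[of "- x"] that by auto
  ultimately show "signed_perm (S - A) f"
    using f assms by (auto simp: signed_perm_def)
qed

lemma cycles_signed_Un:
  assumes "signed_perm A f" "signed_perm B f" "A \<inter> B = {}"
  shows "cycles (A \<union> B) f = cycles A f + cycles B f"
    "cycles (abs ` (A \<union> B)) (abs \<circ> f) = cycles (abs ` A) (abs \<circ> f) + cycles (abs ` B) (abs \<circ> f)"
proof -
  note A = signed_permD[OF assms(1)] and B = signed_permD[OF assms(2)]
  show "cycles (A \<union> B) f = cycles A f + cycles B f"
    using A B assms(3) by (intro cycles_Un_disjoint)
  have "abs ` A \<inter> abs ` B = {}"
    using A(8) B(8) assms(3) by blast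
  then show "cycles (abs ` (A \<union> B)) (abs \<circ> f) =
      cycles (abs ` A) (abs \<circ> f) + cycles (abs ` B) (abs \<circ> f)"
    using A B bij_betw_abs_comp[OF assms(1)] bij_betw_abs_comp[OF assms(2)]
    by (simp only: image_Un cycles_Un_disjoint)
qed

section \<open>The length function\<close>

lemma signed_set_iff: "x \<in> signed_set n \<longleftrightarrow> x \<noteq> 0 \<and> \<bar>x\<bar> \<le> int n"
proof -
  have "x \<in> uminus ` {1..int n} \<longleftrightarrow> - x \<in> {1..int n}"
    by force
  then show ?thesis
    by (auto simp: signed_set_def)
qed

lemma finite_signed_set: "finite (signed_set n)"
  by (simp add: signed_set_def)

lemma abs_signed_set: "abs ` signed_set n = {1..int n}"
proof (intro equalityI subsetI)
  fix x assume "x \<in> {1..int n}"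
  then show "x \<in> abs ` signed_set n"
    by (intro image_eqI[of _ _ x]) (auto simp: signed_set_iff)
qed (auto simp: signed_set_iff)

lemma hyperoctahedral_signed_perm:
  "f \<in> hyperoctahedral n \<Longrightarrow> signed_perm (signed_set n) f"
  by (auto simp: hyperoctahedral_def signed_perm_def finite_signed_set signed_set_iff
      intro: permutes_imp_bij)

lemma hyperoctahedral_permutes: "f \<in> hyperoctahedral n \<Longrightarrow> f permutes signed_set n"
  by (simp add: hyperoctahedral_def)

lemma hyperoctahedral_comp:
  assumes "f \<in> hyperoctahedral n" "g \<in> hyperoctahedral n"
  shows "f \<circ> g \<in> hyperoctahedral n"
  using assms permutes_in_image[of g "signed_set n"]
  by (auto simp: hyperoctahedral_def permutes_compose)

lemma hyperoctahedral_inv: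
  assumes "f \<in> hyperoctahedral n"
  shows "inv_into UNIV f \<in> hyperoctahedral n"
proof -
  have f: "f permutes signed_set n"
    using assms by (rule hyperoctahedral_permutes)
  have "inv_into UNIV f (- x) = - inv_into UNIV f x" if "x \<in> signed_set n" for x
  proof -
    have "inv_into UNIV f x \<in> signed_set n"
      using that permutes_in_image[OF permutes_inv[OF f]] by simp
    then have "f (- inv_into UNIV f x) = - x"
      using assms permutes_inverses(1)[OF f] by (simp add: hyperoctahedral_def)
    then show ?thesis
      using permutes_inverses(2)[OF f] by metis
  qed
  then show ?thesis
    using f by (simp add: hyperoctahedral_def permutes_inv)
qed

text \<open>Arguments of either sign are allowed, so that the first two families in
  \<open>reflections_B\<close> become one.\<close>

definition refl_B :: "int \<Rightarrow> int \<Rightarrow> int \<Rightarrow> int"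
  where "refl_B i j = transpose i j \<circ> transpose (- i) (- j)"

lemma refl_B_sym: "refl_B i j = refl_B j i"
  by (simp add: refl_B_def transpose_commute)

lemma refl_B_uminus: "i \<noteq> 0 \<Longrightarrow> j \<noteq> 0 \<Longrightarrow> \<bar>i\<bar> \<noteq> \<bar>j\<bar> \<Longrightarrow> refl_B (- i) (- j) = refl_B i j"
  by (auto simp: refl_B_def fun_eq_iff transpose_def)

text \<open>Exchanging the arguments of \<open>refl_B\<close> or negating both changes nothing, so
  one may assume \<open>0 < i\<close> and \<open>i < \<bar>j\<bar>\<close>; the sign of
  \<open>j\<close> then selects the family.\<close>

lemma reflections_B_eq:
  "reflections_B n = {refl_B i j | i j. i \<in> signed_set n \<and> j \<in> signed_set n \<and> \<bar>i\<bar> \<noteq> \<bar>j\<bar>} \<union>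
    {transpose i (- i) | i. i \<in> signed_set n}" (is "_ = ?A \<union> ?B")
proof (intro equalityI subsetI)
  fix r assume "r \<in> reflections_B n"
  then consider i j where "r = refl_B i j" "1 \<le> i" "i < j" "j \<le> int n"
    | i j where "r = refl_B i (- j)" "1 \<le> i" "i < j" "j \<le> int n"
    | i where "r = transpose i (- i)" "1 \<le> i" "i \<le> int n"
    unfolding reflections_B_def refl_B_def by auto
  then show "r \<in> ?A \<union> ?B"
  proof cases
    case (1 i j)
    then have "r \<in> ?A"
      by (intro CollectI exI[of _ i] exI[of _ j]) (simp add: signed_set_iff)
    then show ?thesis ..
  next
    case (2 i j)
    then have "r \<in> ?A"
      by (intro CollectI exI[of _ i] exI[of _ "- j"]) (simp add: signed_set_iff)
    then show ?thesis ..
  next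
    case (3 i)
    then have "r \<in> ?B"
      by (intro CollectI exI[of _ i]) (simp add: signed_set_iff)
    then show ?thesis ..
  qed
next
  have pos: "refl_B i j \<in> reflections_B n"
    if "0 < i" "i < \<bar>j\<bar>" "\<bar>j\<bar> \<le> int n" for i j
  proof (cases "0 < j")
    case True
    then have "1 \<le> i \<and> i < j \<and> j \<le> int n"
      using that by simp
    then show ?thesis
      unfolding reflections_B_def refl_B_def by blast
  next
    case False
    then have "refl_B i j = transpose i (- (- j)) \<circ> transpose (- i) (- j)"
      "1 \<le> i \<and> i < - j \<and> - j \<le> int n"
      using that by (auto simp: refl_B_def)
    then show ?thesis
      unfolding reflections_B_def by blast
  qed
  have lt: "refl_B i j \<in> reflections_B n"
    if "i \<noteq> 0" "\<bar>i\<bar> < \<bar>j\<bar>" "\<bar>j\<bar> \<le> int n" for i j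
  proof (cases "0 < i")
    case True
    then show ?thesis using that pos by simp
  next
    case False
    then have "refl_B (- i) (- j) \<in> reflections_B n"
      using that pos[of "- i" "- j"] by simp
    then show ?thesis
      using that refl_B_uminus[of i j] by simp
  qed
  fix r assume "r \<in> ?A \<union> ?B"
  then consider i j where "r = refl_B i j" "i \<in> signed_set n" "j \<in> signed_set n" "\<bar>i\<bar> \<noteq> \<bar>j\<bar>"
    | i where "r = transpose i (- i)" "i \<in> signed_set n"
    by blast
  then show "r \<in> reflections_B n"
  proof cases
    case (1 i j)
    then show ?thesis
      using lt[of i j] lt[of j i] refl_B_sym[of i j]
      by (cases "\<bar>i\<bar> < \<bar>j\<bar>") (auto simp: signed_set_iff)
  next
    case (2 i)
    have "r = transpose \<bar>i\<bar> (- \<bar>i\<bar>)"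
      using 2 by (simp add: abs_if transpose_commute)
    moreover have "1 \<le> \<bar>i\<bar> \<and> \<bar>i\<bar> \<le> int n"
      using 2 by (auto simp: signed_set_iff)
    ultimately show ?thesis
      unfolding reflections_B_def by blast
  qed
qed

lemma reflections_B_hyperoctahedral:
  assumes "r \<in> reflections_B n"
  shows "r \<in> hyperoctahedral n"
proof -
  consider i j where "r = refl_B i j" "i \<in> signed_set n" "j \<in> signed_set n" "\<bar>i\<bar> \<noteq> \<bar>j\<bar>"
    | i where "r = transpose i (- i)" "i \<in> signed_set n"
    using assms unfolding reflections_B_eq by blast
  then show ?thesis
  proof cases
    case (1 i j)
    then have "r permutes signed_set n"
      unfolding 1(1) refl_B_def by (intro permutes_compose permutes_swap_id) (auto simp: signed_set_iff)
    moreover have "r (- x) = - r x" if "x \<noteq> 0" for x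
      using 1 that by (auto simp: signed_set_iff refl_B_def transpose_def)
    ultimately show ?thesis
      by (auto simp: hyperoctahedral_def signed_set_iff)
  next
    case (2 i)
    then have "r permutes signed_set n"
      unfolding 2(1) by (intro permutes_swap_id) (auto simp: signed_set_iff)
    moreover have "r (- x) = - r x" if "x \<noteq> 0" for x
      using 2 that by (auto simp: signed_set_iff transpose_def)
    ultimately show ?thesis
      by (auto simp: hyperoctahedral_def signed_set_iff)
  qed
qed

lemma refl_B_involution:
  assumes "i \<noteq> 0" "j \<noteq> 0" "\<bar>i\<bar> \<noteq> \<bar>j\<bar>"
  shows "refl_B i j \<circ> refl_B i j = id"
  using assms by (auto simp: refl_B_def fun_eq_iff transpose_def)

text \<open>The transposition of \<open>i\<close> and \<open>- i\<close> induces the identity on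
  absolute values.\<close>

lemma cycles_abs_transpose:
  fixes f :: "int \<Rightarrow> int"
  shows "cycles (abs ` S) (abs \<circ> (transpose i (- i) \<circ> f)) = cycles (abs ` S) (abs \<circ> f)"
  by (intro arg_cong[where f = "num_classes (abs ` S)"] fgraph_cong) (auto simp: transpose_def)

lemma cycles_abs_refl_B:
  assumes "i \<noteq> 0" "j \<noteq> 0"
  shows "cycles (abs ` S) (abs \<circ> (refl_B i j \<circ> f)) =
    cycles (abs ` S) (transpose \<bar>i\<bar> \<bar>j\<bar> \<circ> (abs \<circ> f))"
proof -
  have "abs (refl_B i j y) = transpose (abs i) (abs j) (abs y)" for y
    using assms by (auto simp: refl_B_def transpose_def abs_if)
  then show ?thesis
    by (intro arg_cong[where f = "num_classes (abs ` S)"] fgraph_cong) simp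
qed

text \<open>In other words, \<open>c - q\<close> drops by at most one. Two transpositions lower
  \<open>c\<close> by at most two, which suffices if the quotient loses a cycle. If it gains one,
  the two transpositions must not both merge.\<close>

lemma refl_B_step:
  assumes "signed_perm S f" "i \<in> S" "j \<in> S" "\<bar>i\<bar> \<noteq> \<bar>j\<bar>"
  shows "cycles (abs ` S) (abs \<circ> (refl_B i j \<circ> f)) + cycles S f
    \<le> cycles S (refl_B i j \<circ> f) + cycles (abs ` S) (abs \<circ> f) + 1"
proof -
  note f = signed_permD[OF assms(1)]
  let ?g = "transpose (- i) (- j) \<circ> f"
  have ij: "i \<noteq> j" "- i \<noteq> - j" "- i \<in> S" "- j \<in> S" "\<bar>i\<bar> \<in> abs ` S" "\<bar>j\<bar> \<in> abs ` S"
    using assms f by auto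
  have g: "bij_betw ?g S S"
    using ij f(3) by (intro bij_betw_transpose_comp)
  have rf: "refl_B i j \<circ> f = transpose i j \<circ> ?g"
    by (simp add: refl_B_def o_assoc)
  have nz: "i \<noteq> 0" "j \<noteq> 0"
    using assms(2,3) f(2) by auto
  note T = f(4) bij_betw_abs_comp[OF assms(1)] ij(5,6)
  have c1: "cycles S ?g + (if linked S f (- i) (- j) then 0 else 1)
      = cycles S f + (if linked S f (- i) (- j) then 1 else 0)"
    using cycles_transpose_split[OF f(1,3) ij(3,4,2)] cycles_transpose_merge[OF f(1,3) ij(3,4)]
    by simp
  have c2: "cycles S (refl_B i j \<circ> f) + (if linked S ?g i j then 0 else 1)
      = cycles S ?g + (if linked S ?g i j then 1 else 0)"
    unfolding rf
    using cycles_transpose_split[OF f(1) g assms(2,3) ij(1)]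
      cycles_transpose_merge[OF f(1) g assms(2,3)]
    by simp
  show ?thesis
  proof (cases "linked (abs ` S) (abs \<circ> f) \<bar>i\<bar> \<bar>j\<bar>")
    case False
    then have "cycles (abs ` S) (abs \<circ> f) = cycles (abs ` S) (abs \<circ> (refl_B i j \<circ> f)) + 1"
      unfolding cycles_abs_refl_B[OF nz] using cycles_transpose_merge[OF T] by blast
    then show ?thesis
      using c1 c2 by (auto split: if_splits)
  next
    case True
    then have "cycles (abs ` S) (abs \<circ> (refl_B i j \<circ> f)) = cycles (abs ` S) (abs \<circ> f) + 1"
      unfolding cycles_abs_refl_B[OF nz] using cycles_transpose_split[OF T assms(4)] by blast
    \<comment> \<open>Here \<open>i\<close> is linked with \<open>- j\<close> and \<open>- i\<close>
      with \<open>j\<close>. Merging the cycles of \<open>- i\<close> and \<open>- j\<close> puts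
      all four points on one cycle, which the second transposition then splits.\<close>
    moreover have "linked S ?g i j" if "\<not> linked S f (- i) (- j)"
    proof -
      have "linked S f i (- j)"
        using True that linked_abs_comp_iff[OF assms(1), of i j] linked_uminus[OF assms(1), of i j]
        by auto
      then have "linked S f i (- j)" "linked S f (- i) j"
        using linked_uminus[OF assms(1), of i "- j"] by auto
      then have "linked S ?g i (- j)" "linked S ?g (- i) j"
        using linked_transpose_merge_mono[OF f(1,3) ij(3,4) that] by blast+
      moreover have "linked S ?g (- i) (- j)"
        using equivclp_transpose_merge[OF f(1,3) ij(3,4) that] .
      ultimately show ?thesis
        by (meson equivclp_sym equivclp_trans)
    qed
    ultimately show ?thesis
      using c1 c2 by (auto split: if_splits)
  qed
qed

lemma reflection_step:
  assumes "f \<in> hyperoctahedral n" "r \<in> reflections_B n"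
  shows "cycles {1..int n} (abs \<circ> (r \<circ> f)) + cycles (signed_set n) f
    \<le> cycles (signed_set n) (r \<circ> f) + cycles {1..int n} (abs \<circ> f) + 1"
proof -
  have f: "signed_perm (signed_set n) f"
    using assms(1) by (rule hyperoctahedral_signed_perm)
  consider i j where "r = refl_B i j" "i \<in> signed_set n" "j \<in> signed_set n" "\<bar>i\<bar> \<noteq> \<bar>j\<bar>"
    | i where "r = transpose i (- i)" "i \<in> signed_set n"
    using assms(2) unfolding reflections_B_eq by blast
  then show ?thesis
  proof cases
    case (1 i j)
    then show ?thesis
      using refl_B_step[OF f] unfolding abs_signed_set by blast
  next
    case (2 i)
    then have i: "i \<in> signed_set n" "- i \<in> signed_set n" "i \<noteq> - i"
      by (auto simp: signed_set_iff)
    have "cycles {1..int n} (abs \<circ> (r \<circ> f)) = cycles {1..int n} (abs \<circ> f)"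
      unfolding 2(1) using cycles_abs_transpose[of "signed_set n" i f] by (simp only: abs_signed_set)
    moreover have "cycles (signed_set n) f \<le> cycles (signed_set n) (r \<circ> f) + 1"
      unfolding 2(1)
      using cycles_transpose_split[OF signed_permD(1,3)[OF f] i]
        cycles_transpose_merge[OF signed_permD(1,3)[OF f] i(1,2)] by fastforce
    ultimately show ?thesis
      by simp
  qed
qed

section \<open>The length in terms of cycle counts\<close>

lemma cycles_id_signed:
  "cycles (signed_set n) id = 2 * n" "cycles {1..int n} (abs \<circ> id) = n"
proof -
  have "signed_perm (signed_set n) id"
    by (auto simp: signed_perm_def finite_signed_set signed_set_iff)
  then have "card (signed_set n) = 2 * n"
    using card_eq_double_card_abs abs_signed_set by fastforce
  then show "cycles (signed_set n) id = 2 * n"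
    by (simp add: cycles_id_on)
  show "cycles {1..int n} (abs \<circ> id) = n"
    using cycles_id_on[of "{1..int n}" "abs \<circ> id"] by simp
qed

text \<open>The identity has \<open>c - q = n\<close>, and each letter lowers \<open>c - q\<close>
  by at most one. This is the lower bound for the length.\<close>

lemma reflection_word_length_ge:
  assumes "set rs \<subseteq> reflections_B n"
  shows "foldr (\<circ>) rs id \<in> hyperoctahedral n \<and>
    n + cycles {1..int n} (abs \<circ> foldr (\<circ>) rs id)
      \<le> cycles (signed_set n) (foldr (\<circ>) rs id) + length rs"
  using assms
proof (induction rs)
  case Nil
  have "id \<in> hyperoctahedral n"
    by (simp add: hyperoctahedral_def permutes_id)
  moreover have "foldr (\<circ>) [] id = (id :: int \<Rightarrow> int)"
    by simp
  ultimately show ?case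
    by (simp only: cycles_id_signed) simp
next
  case (Cons r rs)
  define g where "g = foldr (\<circ>) rs id"
  have rs: "r \<in> reflections_B n" "set rs \<subseteq> reflections_B n"
    using Cons.prems by auto
  then have g: "g \<in> hyperoctahedral n"
    "n + cycles {1..int n} (abs \<circ> g) \<le> cycles (signed_set n) g + length rs"
    using Cons.IH unfolding g_def by blast+
  then have "r \<circ> g \<in> hyperoctahedral n"
    using rs(1) hyperoctahedral_comp reflections_B_hyperoctahedral by blast
  moreover have "foldr (\<circ>) (r # rs) id = r \<circ> g"
    by (simp add: g_def)
  ultimately show ?case
    using reflection_step[OF g(1) rs(1)] g(2) by (simp only: list.size simp_thms)
qed

text \<open>If \<open>f\<close> changes some absolute value, \<open>refl_B i (f i)\<close> splits
  two cycles above and one in the quotient. Otherwise some \<open>i\<close> is sent to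
  \<open>- i\<close>, and \<open>transpose i (- i)\<close> splits one cycle and keeps the quotient.
  Either way \<open>c - q\<close> grows by one.\<close>

lemma ex_decreasing_reflection:
  assumes "f \<in> hyperoctahedral n" "f \<noteq> id"
  obtains r where "r \<in> reflections_B n" "r \<circ> r = id"
    "cycles (signed_set n) (r \<circ> f) > cycles (signed_set n) f"
    "cycles (signed_set n) (r \<circ> f) + cycles {1..int n} (abs \<circ> f)
      = cycles (signed_set n) f + cycles {1..int n} (abs \<circ> (r \<circ> f)) + 1"
proof -
  let ?S = "signed_set n"
  have sf: "signed_perm ?S f"
    using assms(1) by (rule hyperoctahedral_signed_perm)
  note f = signed_permD[OF sf]
  show thesis
  proof (cases "\<exists>i\<in>?S. \<bar>f i\<bar> \<noteq> \<bar>i\<bar>")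
    case True
    then obtain i j where i: "i \<in> ?S" "j = f i" "\<bar>i\<bar> \<noteq> \<bar>j\<bar>"
      by metis
    let ?g = "transpose (- i) (- j) \<circ> f"
    have ij: "j \<in> ?S" "i \<noteq> j" "- i \<noteq> - j" "- i \<in> ?S" "- j \<in> ?S" "\<bar>i\<bar> \<in> abs ` ?S" "\<bar>j\<bar> \<in> abs ` ?S"
      using i f by auto
    have nz: "i \<noteq> 0" "j \<noteq> 0"
      using i(1) ij(1) f(2) by auto
    have g: "bij_betw ?g ?S ?S"
      using ij f(3) by (intro bij_betw_transpose_comp)
    have "fgraph ?S f (- i) (- j)"
      using i f ij by (simp add: fgraph_def)
    then have "linked ?S f (- i) (- j)"
      by blast
    then have c1: "cycles ?S ?g = cycles ?S f + 1"
      using cycles_transpose_split[OF f(1,3) ij(4,5,3)] by simp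
    \<comment> \<open>The first transposition moves only \<open>- i\<close> and \<open>- j\<close>,
      so the edge from \<open>i\<close> to \<open>j\<close> survives and the second transposition
      splits again.\<close>
    have "?g i = j"
      using i nz by (auto simp: transpose_def)
    then have "fgraph ?S ?g i j"
      using i(1) by (simp add: fgraph_def)
    then have "linked ?S ?g i j"
      by blast
    then have "cycles ?S (transpose i j \<circ> ?g) = cycles ?S f + 2"
      using cycles_transpose_split[OF f(1) g i(1) ij(1,2)] c1 by simp
    moreover have "refl_B i j \<circ> f = transpose i j \<circ> ?g"
      by (simp add: refl_B_def o_assoc)
    ultimately have c2: "cycles ?S (refl_B i j \<circ> f) = cycles ?S f + 2"
      by simp
    have "fgraph ?S f i j"
      using i by (simp add: fgraph_def)
    then have "linked (abs ` ?S) (abs \<circ> f) \<bar>i\<bar> \<bar>j\<bar>"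
      using linked_abs_comp[OF sf] by blast
    then have "cycles (abs ` ?S) (abs \<circ> (refl_B i j \<circ> f)) = cycles (abs ` ?S) (abs \<circ> f) + 1"
      unfolding cycles_abs_refl_B[OF nz]
      using cycles_transpose_split[OF f(4) bij_betw_abs_comp[OF sf] ij(6,7) i(3)] by simp
    moreover have "refl_B i j \<in> reflections_B n"
      unfolding reflections_B_eq using i ij(1) by blast
    ultimately show thesis
      using that[of "refl_B i j"] c2 refl_B_involution[OF nz i(3)] unfolding abs_signed_set by simp
  next
    case False
    have "\<exists>i\<in>?S. f i \<noteq> i"
    proof (rule ccontr)
      assume "\<not> (\<exists>i\<in>?S. f i \<noteq> i)"
      then have "f = id"
        using hyperoctahedral_permutes[OF assms(1)] by (auto simp: fun_eq_iff permutes_def)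
      then show False
        using assms(2) by simp
    qed
    then obtain i where i: "i \<in> ?S" "f i \<noteq> i"
      by blast
    then have fi: "f i = - i"
      using False by (metis abs_eq_iff)
    have i': "- i \<in> ?S" "i \<noteq> - i"
      using i(1) by (auto simp: signed_set_iff)
    have "fgraph ?S f i (- i)"
      using i fi by (simp add: fgraph_def)
    then have "linked ?S f i (- i)"
      by blast
    then have "cycles ?S (transpose i (- i) \<circ> f) = cycles ?S f + 1"
      using cycles_transpose_split[OF f(1,3) i(1) i'] by simp
    moreover have "transpose i (- i) \<in> reflections_B n"
      unfolding reflections_B_eq using i(1) by blast
    ultimately show thesis
      using that[of "transpose i (- i)"] cycles_abs_transpose[of ?S i f]
      unfolding abs_signed_set by (simp add: transpose_comp_involutory)
  qed
qed

text \<open>Stripping reflections that raise \<open>c - q\<close> by one ends at the identity; since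
  they are involutions, putting them back in front recovers \<open>f\<close>. The growth of
  \<open>c\<close> ensures termination.\<close>

lemma ex_reflection_word:
  assumes "f \<in> hyperoctahedral n"
  shows "\<exists>rs. set rs \<subseteq> reflections_B n \<and> foldr (\<circ>) rs id = f \<and>
    length rs + cycles (signed_set n) f = n + cycles {1..int n} (abs \<circ> f)"
  using assms
proof (induction "card (signed_set n) - cycles (signed_set n) f" arbitrary: f rule: less_induct)
  case less
  show ?case
  proof (cases "f = id")
    case True
    then show ?thesis
      by (intro exI[of _ "[]"]) (simp only: cycles_id_signed, simp)
  next
    case False
    obtain r where r: "r \<in> reflections_B n" "r \<circ> r = id"
      "cycles (signed_set n) (r \<circ> f) > cycles (signed_set n) f"
      "cycles (signed_set n) (r \<circ> f) + cycles {1..int n} (abs \<circ> f)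
        = cycles (signed_set n) f + cycles {1..int n} (abs \<circ> (r \<circ> f)) + 1"
      using ex_decreasing_reflection[OF less.prems False] .
    have "card (signed_set n) - cycles (signed_set n) (r \<circ> f)
        < card (signed_set n) - cycles (signed_set n) f"
      using r(3) cycles_le_card[OF finite_signed_set, of n "r \<circ> f"] by linarith
    moreover have "r \<circ> f \<in> hyperoctahedral n"
      using hyperoctahedral_comp reflections_B_hyperoctahedral r(1) less.prems by blast
    ultimately obtain rs where rs: "set rs \<subseteq> reflections_B n" "foldr (\<circ>) rs id = r \<circ> f"
      "length rs + cycles (signed_set n) (r \<circ> f) = n + cycles {1..int n} (abs \<circ> (r \<circ> f))"
      using less.hyps by blast
    have "foldr (\<circ>) (r # rs) id = f"
      using rs(2) r(2) by (simp add: o_assoc)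
    then show ?thesis
      using rs(1,3) r(1,4) by (intro exI[of _ "r # rs"]) auto
  qed
qed

text \<open>The lower bound \<open>reflection_word_length_ge\<close> is attained by
  \<open>ex_reflection_word\<close>. The additive form avoids truncated subtraction.\<close>

lemma length_B_eq:
  assumes "f \<in> hyperoctahedral n"
  shows "length_B n f + cycles (signed_set n) f = n + cycles {1..int n} (abs \<circ> f)"
proof -
  obtain rs where rs: "set rs \<subseteq> reflections_B n" "foldr (\<circ>) rs id = f"
    "length rs + cycles (signed_set n) f = n + cycles {1..int n} (abs \<circ> f)"
    using ex_reflection_word[OF assms] by blast
  have "length_B n f = length rs"
    unfolding length_B_def
  proof (rule Least_equality)
    fix k assume "\<exists>rs. length rs = k \<and> set rs \<subseteq> reflections_B n \<and> foldr (\<circ>) rs id = f"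
    then show "length rs \<le> k"
      using reflection_word_length_ge rs(3) by fastforce
  qed (use rs in blast)
  then show ?thesis
    using rs(3) by simp
qed

section \<open>The two cycles of \<open>\<gamma>\<close>\<close>

text \<open>The \<open>k\<close>-th power of the cycle rotates the list by \<open>k\<close>, so it
  carries the head to the entry at index \<open>k\<close>.\<close>

lemma cycles_cycle_of_list:
  assumes "distinct cs" "cs \<noteq> []"
  shows "cycles (set cs) (cycle_of_list cs) = 1"
proof -
  let ?f = "cycle_of_list cs"
  have bij: "bij_betw ?f (set cs) (set cs)"
    using cycle_permutes permutes_imp_bij by blast
  have "linked (set cs) ?f (hd cs) x" if x: "x \<in> set cs" for x
  proof -
    obtain k where k: "k < length cs" "x = cs ! k"
      using x by (auto simp: in_set_conv_nth)
    have "(?f ^^ k) (hd cs) = hd (map (?f ^^ k) cs)"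
      using assms(2) by (simp add: hd_map)
    also have "\<dots> = hd (rotate k cs)"
      using cyclic_rotation[OF assms(1)] by simp
    also have "\<dots> = x"
      using k by (simp add: hd_rotate_conv_nth assms(2))
    finally show ?thesis
      using equivclp_fgraph_iff_funpow[OF _ bij, of "hd cs"] assms(2) by auto
  qed
  then have "cycles (set cs) ?f \<le> card {hd cs}"
    by (intro num_classes_le_cardI) auto
  moreover have "cycles (set cs) ?f \<noteq> 0"
    using assms(2) by (simp add: num_classes_def)
  ultimately show ?thesis
    by simp
qed

lemma cycles_signed_cycle:
  assumes "0 < a" "a \<le> b"
  shows "cycles ({a..b} \<union> uminus ` {a..b}) (signed_cycle a b) = 1"
proof -
  have "distinct ([a..b] @ map uminus [a..b])"
    using assms by (auto simp: distinct_map inj_on_def)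
  then show ?thesis
    using cycles_cycle_of_list[of "[a..b] @ map uminus [a..b]"] assms
    by (simp add: signed_cycle_def)
qed

lemma linked_of_cycles_eq_1:
  assumes "cycles S f = 1" "x \<in> S" "y \<in> S"
  shows "linked S f x y"
proof -
  let ?c = "\<lambda>x. Collect (linked S f x)"
  obtain C where C: "?c ` S = {C}"
    using assms(1) unfolding num_classes_def by (rule card_1_singletonE)
  have "?c x \<in> ?c ` S" "?c y \<in> ?c ` S"
    using assms(2,3) by (auto intro: imageI)
  then have "?c x = ?c y"
    unfolding C by simp
  then show ?thesis
    by (simp add: Collect_equivclp_eq_iff)
qed

text \<open>\<open>A\<close> and its complement are the supports of the two signed cycles, and on
  each of them \<open>gamma_B\<close> agrees with one signed cycle.\<close>

lemma gamma_B_blocks: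
  assumes "0 < p" "0 < q"
  defines "A \<equiv> {x \<in> signed_set (p + q). \<bar>x\<bar> \<le> int p}"
  shows "gamma_B p q ` A \<subseteq> A" "cycles A (gamma_B p q) = 1"
    "cycles (signed_set (p + q) - A) (gamma_B p q) = 1"
proof -
  let ?B = "signed_set (p + q) - A"
  let ?c = "signed_cycle 1 (int p)" and ?d = "signed_cycle (int p + 1) (int (p + q))"
  have um: "x \<in> uminus ` {a..b} \<longleftrightarrow> - x \<in> {a..b}" for x a b :: int
    by force
  have A: "{1..int p} \<union> uminus ` {1..int p} = A"
    by (auto simp: A_def signed_set_iff um)
  have B: "{int p + 1..int (p + q)} \<union> uminus ` {int p + 1..int (p + q)} = ?B"
    by (auto simp: A_def signed_set_iff um)
  have c: "?c permutes A" and d: "?d permutes ?B"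
    using signed_cycle_permutes[of 1 "int p"] signed_cycle_permutes[of "int p + 1" "int (p + q)"]
    unfolding A B by auto
  have gA: "gamma_B p q x = ?c x" if "x \<in> A" for x
    using that permutes_not_in[OF d, of x] by (simp add: gamma_B_def)
  have gB: "gamma_B p q x = ?d x" if "x \<in> ?B" for x
    using that permutes_in_image[OF d, of x] permutes_not_in[OF c, of "?d x"]
    by (simp add: gamma_B_def)
  show "gamma_B p q ` A \<subseteq> A"
    using gA permutes_in_image[OF c] by auto
  have "cycles A (gamma_B p q) = cycles A ?c"
    using gA fgraph_cong by metis
  then show "cycles A (gamma_B p q) = 1"
    using cycles_signed_cycle[of 1 "int p"] assms(1) unfolding A by simp
  have "cycles ?B (gamma_B p q) = cycles ?B ?d"
    using gB fgraph_cong by metis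
  then show "cycles ?B (gamma_B p q) = 1"
    using cycles_signed_cycle[of "int p + 1" "int (p + q)"] assms(2) unfolding B by simp
qed

text \<open>If \<open>r\<close> preserves \<open>A\<close>, there are at most two joint orbits and
  the parity argument applies to each block. If not, there is a single joint orbit and doubling the
  quotient count suffices.\<close>

lemma cycles_two_blocks:
  assumes r: "signed_perm S r" and g: "signed_perm S g"
    and A: "A \<subseteq> S" "\<And>x. x \<in> A \<Longrightarrow> - x \<in> A" "A \<noteq> {}" "g ` A \<subseteq> A"
    and one: "cycles A g = 1" "cycles (S - A) g = 1"
  shows "cycles S g = 2" "cycles (abs ` S) (abs \<circ> g) = 2"
    "cycles S r + cycles S (r \<circ> g) + 2 * num_classes S (sup (fgraph S r) (fgraph S g))
      \<le> 2 * (cycles (abs ` S) (abs \<circ> r) + cycles (abs ` S) (abs \<circ> (r \<circ> g))) + 2"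
proof -
  let ?B = "S - A"
  let ?E = "sup (fgraph S r) (fgraph S g)"
  have S: "A \<union> ?B = S" "A \<inter> ?B = {}"
    using A(1) by auto
  have gAB: "signed_perm A g" "signed_perm ?B g"
    using signed_perm_subset[OF g A(1,2,4)] by auto
  note Un = cycles_signed_Un[OF _ _ S(2), unfolded S(1)]
  show "cycles S g = 2"
    using Un(1)[OF gAB] one by simp
  \<comment> \<open>The quotient count is at most the cycle count 1, and twice the quotient count is
    at least 1.\<close>
  have "cycles (abs ` A) (abs \<circ> g) = 1" "cycles (abs ` ?B) (abs \<circ> g) = 1"
    using cycles_abs_le_cycles[OF gAB(1)] cycles_le_double_cycles_abs[OF gAB(1)]
      cycles_abs_le_cycles[OF gAB(2)] cycles_le_double_cycles_abs[OF gAB(2)] one by linarith+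
  then show "cycles (abs ` S) (abs \<circ> g) = 2"
    using Un(2)[OF gAB] by simp
  have "linked S g x y" if "linked C g x y" "C \<subseteq> S" for C x y
  proof -
    have "fgraph C g \<le> fgraph S g"
      using that(2) by (auto simp: fgraph_def)
    then show ?thesis
      using that(1) by (blast intro: equivclp_least)
  qed
  then have "equivclp ?E x y" if "linked C g x y" "C \<subseteq> S" for C x y
    using that by (blast intro: equivclp_least)
  then have link: "equivclp ?E x y" if "x \<in> A \<and> y \<in> A \<or> x \<in> ?B \<and> y \<in> ?B" for x y
    using that linked_of_cycles_eq_1[OF one(1)] linked_of_cycles_eq_1[OF one(2)] A(1) by blast
  have rg: "signed_perm S (r \<circ> g)"
    using r g by (rule signed_perm_comp)
  show "cycles S r + cycles S (r \<circ> g) + 2 * num_classes S ?E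
      \<le> 2 * (cycles (abs ` S) (abs \<circ> r) + cycles (abs ` S) (abs \<circ> (r \<circ> g))) + 2"
  proof (cases "r ` A \<subseteq> A")
    case True
    have "?B \<noteq> {}"
    proof
      assume "?B = {}"
      then show False
        using one(2) by (simp only: num_classes_def) simp
    qed
    then obtain a b where ab: "a \<in> A" "b \<in> ?B"
      using A(3) by blast
    have "num_classes S ?E \<le> card {a, b}"
      by (rule num_classes_le_cardI) (use link ab in auto)
    also have "\<dots> \<le> 2"
      by (simp add: card_insert_if)
    finally have "num_classes S ?E \<le> 2" .
    moreover have rAB: "signed_perm A r" "signed_perm ?B r"
      using signed_perm_subset[OF r A(1,2) True] by auto
    \<comment> \<open>\<open>cycles_single_block\<close> leaves a slack of one on each block; the
      total of two covers a second joint orbit.\<close>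
    ultimately show ?thesis
      using cycles_single_block[OF rAB(1) gAB(1) one(1)] cycles_single_block[OF rAB(2) gAB(2) one(2)]
        Un[OF rAB] Un[OF signed_perm_comp[OF rAB(1) gAB(1)] signed_perm_comp[OF rAB(2) gAB(2)]]
      by simp
  next
    case False
    then obtain a where a: "a \<in> A" "r a \<in> ?B"
      using A(1) signed_permD(7)[OF r] by blast
    \<comment> \<open>This edge crosses between the blocks, each of which lies within one joint
      orbit, so everything is joined to \<open>a\<close>.\<close>
    have "?E a (r a)"
      using a(1) A(1) by (auto simp: fgraph_def)
    then have ra: "equivclp ?E a (r a)"
      by blast
    have "num_classes S ?E \<le> card {a}"
    proof (rule num_classes_le_cardI)
      fix x assume "x \<in> S"
      then show "\<exists>c\<in>{a}. equivclp ?E c x"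
        using link[of a x] link[of "r a" x] a equivclp_trans[OF ra] by blast
    qed simp
    then show ?thesis
      using cycles_le_double_cycles_abs[OF r] cycles_le_double_cycles_abs[OF rg] by simp
  qed
qed

theorem theorem1p1:
  fixes p q n :: nat
  assumes "0 < p" and "0 < q" and "n = p + q"
  shows "noncrossing_B p q = {\<tau> \<in> hyperoctahedral n. le_B n \<tau> (gamma_B p q)}"
proof -
  let ?X = "signed_set n" and ?T = "{1..int n}" and ?\<gamma> = "gamma_B p q"
  have \<gamma>: "?\<gamma> \<in> hyperoctahedral n"
    using gamma_B_in_hyperoctahedral assms(3) by simp
  have "\<tau> \<in> noncrossing_perms ?X ?\<gamma> \<longleftrightarrow> le_B n \<tau> ?\<gamma>" if \<tau>: "\<tau> \<in> hyperoctahedral n" for \<tau>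
  proof -
    \<comment> \<open>The genus inequalities concern \<open>r\<close>, \<open>g\<close> and
      \<open>r \<circ> g\<close>. Taking the inverse of \<tau> for \<open>r\<close> makes the
      product the permutation of the noncrossing condition, and inversion changes none of the
      counts.\<close>
    define \<rho> where "\<rho> = inv_into UNIV \<tau>"
    have \<rho>: "\<rho> \<in> hyperoctahedral n"
      unfolding \<rho>_def using \<tau> by (rule hyperoctahedral_inv)
    have \<kappa>: "\<rho> \<circ> ?\<gamma> \<in> hyperoctahedral n"
      using \<rho> \<gamma> by (rule hyperoctahedral_comp)
    note perm = hyperoctahedral_permutes and sp = hyperoctahedral_signed_perm
    have inverse: "\<rho> (\<tau> x) = x" for x
      unfolding \<rho>_def using permutes_inverses(2)[OF perm[OF \<tau>]] .
    have "cycles ?X \<rho> = cycles ?X \<tau>"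
      by (rule cycles_inverse) (use inverse signed_permD(3)[OF sp[OF \<tau>]] in auto)
    moreover have "cycles ?T (abs \<circ> \<rho>) = cycles ?T (abs \<circ> \<tau>)"
    proof (rule cycles_inverse)
      show "bij_betw (abs \<circ> \<tau>) ?T ?T"
        using bij_betw_abs_comp[OF sp[OF \<tau>]] by (simp add: abs_signed_set)
      fix x assume "x \<in> ?T"
      then have "x \<in> ?X" "0 < x"
        by (auto simp: signed_set_iff)
      then have "\<bar>\<rho> \<bar>\<tau> x\<bar>\<bar> = \<bar>\<rho> (\<tau> x)\<bar>"
        using signed_permD(9)[OF sp[OF \<rho>]] signed_permD(7)[OF sp[OF \<tau>]] by blast
      then show "(abs \<circ> \<rho>) ((abs \<circ> \<tau>) x) = x"
        using inverse \<open>0 < x\<close> by simp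
    qed
    moreover have "num_classes ?X (sup (fgraph ?X \<rho>) E) = num_classes ?X (sup (fgraph ?X \<tau>) E)" for E
      by (rule num_classes_sup_inverse) (use inverse signed_permD(3)[OF sp[OF \<tau>]] in auto)
    ultimately have conv: "num_cycles ?X \<tau> = cycles ?X \<rho>" "num_cycles ?X (\<rho> \<circ> ?\<gamma>) = cycles ?X (\<rho> \<circ> ?\<gamma>)"
      "num_cycles ?X ?\<gamma> = cycles ?X ?\<gamma>"
      "num_joint_orbits ?X \<tau> ?\<gamma> = num_classes ?X (sup (fgraph ?X \<rho>) (fgraph ?X ?\<gamma>))"
      "length_B n \<tau> + cycles ?X \<rho> = n + cycles ?T (abs \<circ> \<rho>)"
      using num_cycles_eq_cycles[OF finite_signed_set perm] \<tau> \<kappa> \<gamma> length_B_eq[OF \<tau>]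
        num_joint_orbits_eq_num_classes[OF perm[OF \<tau>] perm[OF \<gamma>]]
      by simp_all
    let ?A = "{x \<in> ?X. \<bar>x\<bar> \<le> int p}"
    have one: "?\<gamma> ` ?A \<subseteq> ?A" "cycles ?A ?\<gamma> = 1" "cycles (?X - ?A) ?\<gamma> = 1"
      using gamma_B_blocks[OF assms(1,2)] unfolding assms(3) by auto
    have "1 \<in> ?A"
      using assms by (simp add: signed_set_iff)
    then have "?A \<noteq> {}"
      by blast
    have sub: "?A \<subseteq> ?X" and neg: "\<And>x. x \<in> ?A \<Longrightarrow> - x \<in> ?A"
      by (auto simp: signed_set_iff)
    have blocks: "cycles ?X ?\<gamma> = 2" "cycles ?T (abs \<circ> ?\<gamma>) = 2"
      "cycles ?X \<rho> + cycles ?X (\<rho> \<circ> ?\<gamma>) + 2 * num_classes ?X (sup (fgraph ?X \<rho>) (fgraph ?X ?\<gamma>))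
        \<le> 2 * (cycles ?T (abs \<circ> \<rho>) + cycles ?T (abs \<circ> (\<rho> \<circ> ?\<gamma>))) + 2"
      using cycles_two_blocks[OF sp[OF \<rho>] sp[OF \<gamma>] sub _ \<open>?A \<noteq> {}\<close> one] neg
      unfolding abs_signed_set by blast+
    have card: "card ?T = n" "card ?X = 2 * n"
      using card_eq_double_card_abs[OF sp[OF \<gamma>]] by (simp_all add: abs_signed_set)
    let ?N = "num_classes ?X (sup (fgraph ?X \<rho>) (fgraph ?X ?\<gamma>))"
    have gX: "cycles ?X \<rho> + cycles ?X (\<rho> \<circ> ?\<gamma>) + 2 \<le> 2 * n + 2 * ?N"
      using genus[OF finite_signed_set signed_permD(3)[OF sp[OF \<gamma>]] signed_permD(3)[OF sp[OF \<rho>]]]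
      unfolding card blocks by blast
    have gT: "cycles ?T (abs \<circ> \<rho>) + cycles ?T (abs \<circ> (\<rho> \<circ> ?\<gamma>)) + 2 \<le> n + 2 * ?N"
      using genus_abs[OF sp[OF \<rho>] sp[OF \<gamma>]] unfolding abs_signed_set card blocks .
    have "\<tau> \<in> noncrossing_perms ?X ?\<gamma> \<longleftrightarrow> cycles ?X \<rho> + cycles ?X (\<rho> \<circ> ?\<gamma>) + 2
        = 2 * n + 2 * ?N"
      using perm[OF \<tau>] conv card blocks(1) by (simp add: noncrossing_perms_def \<rho>_def)
    \<comment> \<open>Let \<open>Q\<close> be the sum of the two quotient counts. Either equation
      combined with \<open>blocks(3)\<close> gives \<open>Q + 2 \<ge> n + 2 * ?N\<close>; by
      \<open>gT\<close> this is an equality, and then the two equations agree.\<close>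
    also have "\<dots> \<longleftrightarrow> cycles ?X \<rho> + cycles ?X (\<rho> \<circ> ?\<gamma>)
        = n + cycles ?T (abs \<circ> \<rho>) + cycles ?T (abs \<circ> (\<rho> \<circ> ?\<gamma>))"
      using blocks(3) gX gT by presburger
    \<comment> \<open>Since \<gamma> has two cycles, both in \<open>?X\<close> and in the quotient,
      its length is \<open>n\<close>.\<close>
    also have "\<dots> \<longleftrightarrow> length_B n ?\<gamma> = length_B n \<tau> + length_B n (\<rho> \<circ> ?\<gamma>)"
      using conv(5) length_B_eq[OF \<kappa>] length_B_eq[OF \<gamma>] blocks(1,2) by presburger
    also have "\<dots> \<longleftrightarrow> le_B n \<tau> ?\<gamma>"
      using \<tau> \<gamma> by (simp add: le_B_def \<rho>_def)
    finally show ?thesis .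
  qed
  then show ?thesis
    using assms(3) by (auto simp: noncrossing_B_def)
qed

end
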